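(* Let $f:\mathbb{R}^{n_1}\times\cdots\times\mathbb{R}^{n_m}\to\mathbb{R}$ be convex and differentiable, and suppose there are constants $L_1,\dots,L_m>0$ such that for each $i\in\{1,\dots,m\}$, the partial gradient $\nabla_i f$ is $L_i$-Lipschitz in the $i$-th block when all other blocks are fixed, i.e. $$\|\nabla_i f(x_1,\dots,x_i^1,\dots,x_m)-\nabla_i f(x_1,\dots,x_i^2,\dots,x_m)\|\le L_i\|x_i^1-x_i^2\|$$ for all $x_j$ ($j\ne i$), $x_i^1,x_i^2$. Let each $g_i:\mathbb{R}^{n_i}\to\mathbb{R}\cup\{+\infty\}$ be proper, lower semicontinuous and convex, and let $F(x)=f(x)+\sum_{i=1}^m g_i(x_i)$. Suppose $\min F$ is finite and there is $\nu>0$ such that for all $x$, $$F(x)-\min F\ge\nu\|x-\overline{x}\|^2,$$ where $\overline{x}$ is the projection of $x$ onto $\arg\min F$. For each $i$ let $(\beta_{k,i})_{k\ge 0}\subseteq[0,1)$ be non-increasing, and suppose there are constants $\underline\beta,\overline\beta$ with $$0<\underline\beta\le\beta_{k,i}\le\overline\beta<1\quad\text{for all }k\text{ and }i.$$ Fix $0<c<1$ and set $\gamma_{k,i}=\frac{2(1-\beta_{k,i})c}{L_i}$. Let $(x^k)_{k\ge 0}$ be generated, from given initial points $x^0,x^1$, by the cyclic scheme: for each $k\ge 1$ and $i=1,\dots,m$ in order, $$x_i^{k+1}=\mathbf{prox}_{\gamma_{k,i}g_i}\left[x_i^k-\gamma_{k,i}\nabla_i f(x_1^{k+1},\dots,x_{i-1}^{k+1},x_i^k,\dots,x_m^k)+\beta_{k,i}(x_i^k-x_i^{k-1})\right].$$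 Then there is $\omega\in(0,1)$ such that $$F(x^k)-\min F=O(\omega^k)\quad\text{as }k\to\infty.$$
   Context: $\|\cdot\|$ is the Euclidean norm; $x=(x_1,\dots,x_m)$ with $x_i\in\mathbb{R}^{n_i}$; $\nabla_i f$ is the gradient with respect to block $i$; $\mathbf{prox}_{\gamma h}(y)=\arg\min_z\{h(z)+\frac{1}{2\gamma}\|z-y\|^2\}$. $\min F$ denotes the minimum value of $F$, attained on the nonempty (closed convex) set $\arg\min F$. *)

theory Defs
  imports "HOL-Analysis.Analysis" "HOL-Library.Landau_Symbols"
begin

text \<open>
  The product of the spaces \<open>R^{n_1}, ..., R^{n_m}\<close> is the coordinate space \<open>real ^ 'n\<close> together
  with a map \<open>b\<close> that assigns to every coordinate the number of its block, so that
  \<open>n_i = card {j. b j = i}\<close>.  The factor \<open>R^{n_i}\<close> is the subspace \<open>block_space b i\<close> of the vectors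
  that vanish outside block \<open>i\<close>, with the Euclidean norm inherited from \<open>real ^ 'n\<close>.
\<close>

definition block_space :: "('n \<Rightarrow> nat) \<Rightarrow> nat \<Rightarrow> (real ^ 'n) set" where
  "block_space b i = {z. \<forall>j. b j \<noteq> i \<longrightarrow> z $ j = 0}"

definition block :: "('n \<Rightarrow> nat) \<Rightarrow> nat \<Rightarrow> real ^ 'n \<Rightarrow> real ^ 'n" where
  "block b i x = (\<chi> j. if b j = i then x $ j else 0)"

text \<open>\<open>(x_1, ..., z_i, ..., x_m)\<close>; only block \<open>i\<close> of \<open>z\<close> matters.\<close>

definition subst_block :: "('n \<Rightarrow> nat) \<Rightarrow> nat \<Rightarrow> real ^ 'n \<Rightarrow> real ^ 'n \<Rightarrow> real ^ 'n" where
  "subst_block b i x z = (\<chi> j. if b j = i then z $ j else x $ j)"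

text \<open>\<open>(y_1, ..., y_{i-1}, x_i, ..., x_m)\<close>\<close>

definition sweep_point :: "('n \<Rightarrow> nat) \<Rightarrow> nat \<Rightarrow> real ^ 'n \<Rightarrow> real ^ 'n \<Rightarrow> real ^ 'n" where
  "sweep_point b i y x = (\<chi> j. if b j < i then y $ j else x $ j)"

text \<open>
  The function differentiated here depends on block \<open>i\<close> of \<open>z\<close> only, so its gradient lies in
  \<open>block_space b i\<close> and is the gradient on \<open>R^{n_i}\<close>.
\<close>

definition partial_grad ::
    "('n \<Rightarrow> nat) \<Rightarrow> nat \<Rightarrow> (real ^ 'n::finite \<Rightarrow> real) \<Rightarrow> real ^ 'n \<Rightarrow> real ^ 'n" where
  "partial_grad b i f x = (THE d. GDERIV (\<lambda>z. f (subst_block b i x z)) x :> d)"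

definition proper_on :: "'a set \<Rightarrow> ('a \<Rightarrow> ereal) \<Rightarrow> bool" where
  "proper_on S h \<longleftrightarrow> (\<forall>x\<in>S. h x \<noteq> -\<infinity>) \<and> (\<exists>x\<in>S. h x \<noteq> \<infinity>)"

definition lsc_on :: "'a::topological_space set \<Rightarrow> ('a \<Rightarrow> ereal) \<Rightarrow> bool" where
  "lsc_on S h \<longleftrightarrow> (\<forall>x\<in>S. h x \<le> Liminf (at x within S) h)"

text \<open>
  Strictly positive weights avoid the convention \<open>0 * \<infinity> = 0\<close> of \<open>ereal\<close>.
\<close>

definition econvex_on :: "'a::real_vector set \<Rightarrow> ('a \<Rightarrow> ereal) \<Rightarrow> bool" where
  "econvex_on S h \<longleftrightarrow> convex S \<and>
     (\<forall>x\<in>S. \<forall>y\<in>S. \<forall>u>0. \<forall>v>0. u + v = 1 \<longrightarrow>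
        h (u *\<^sub>R x + v *\<^sub>R y) \<le> ereal u * h x + ereal v * h y)"

definition prox :: "'a::real_normed_vector set \<Rightarrow> real \<Rightarrow> ('a \<Rightarrow> ereal) \<Rightarrow> 'a \<Rightarrow> 'a" where
  "prox S \<gamma> h y = arg_min_on (\<lambda>z. h z + ereal (1 / (2 * \<gamma>) * (norm (z - y))\<^sup>2)) S"

definition composite ::
    "('n \<Rightarrow> nat) \<Rightarrow> nat \<Rightarrow> (real ^ 'n \<Rightarrow> real) \<Rightarrow> (nat \<Rightarrow> real ^ 'n \<Rightarrow> ereal) \<Rightarrow> real ^ 'n \<Rightarrow> ereal" where
  "composite b m f g x = ereal (f x) + (\<Sum>i=1..m. g i (block b i x))"

definition argmin_set :: "('a \<Rightarrow> ereal) \<Rightarrow> 'a set" where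
  "argmin_set F = {x. is_arg_min F (\<lambda>_. True) x}"

definition min_val :: "('a \<Rightarrow> ereal) \<Rightarrow> ereal" where
  "min_val F = (INF x. F x)"

end

theory Submission
  imports Defs
begin

text \<open>
  Write \<open>d_k = x (k + 1) - x k\<close> and \<open>\<delta>_{k,i} = \<beta>_{k,i} / (2 \<gamma>_{k,i})\<close>.  The variational inequality of each
  proximal step, the block-wise descent lemma and Young's inequality for the inertial term show that
  \<open>\<xi>_k = F (x (k + 1)) - min F + \<Sum>i. \<delta>_{k+1,i} |d_{k,i}|\<^sup>2\<close> satisfies \<open>\<xi>_{k+1} + a |d_{k+1}|\<^sup>2 \<le> \<xi>_k\<close>
  for some \<open>a > 0\<close>; here \<open>\<delta>_{k,i}\<close> is non-increasing in \<open>k\<close> because \<open>\<beta>_{k,i}\<close> is.  Convexity makes the full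
  gradient Lipschitz, so comparing \<open>x (k + 1)\<close> with its projection \<open>z\<close> onto the set of minimizers gives
  \<open>F (x (k + 1)) - min F \<le> K (|d_k| + |d_{k-1}|) |x (k + 1) - z|\<close>, and quadratic growth turns this into
  \<open>\<xi>_k \<le> C (|d_k|\<^sup>2 + |d_{k-1}|\<^sup>2)\<close>.  Together, \<open>a \<xi>_{k+2} \<le> C (\<xi>_k - \<xi>_{k+2})\<close>, a contraction over
  two steps.  The proximal points exist because the optimality condition at a minimizer of \<open>F\<close> provides an
  affine minorant of each \<open>g i\<close>.
\<close>

subsection \<open>Lower semicontinuity\<close>

text \<open>The filter \<open>at x within S\<close> leaves out \<open>x\<close> itself, but
  \<open>r < h x\<close> covers that point, so whole neighbourhoods can be used.\<close>

lemma lsc_on_iff_open: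
  fixes h :: "'a::topological_space \<Rightarrow> ereal"
  shows "lsc_on S h \<longleftrightarrow>
    (\<forall>x\<in>S. \<forall>r<h x. \<exists>U. open U \<and> x \<in> U \<and> (\<forall>y\<in>U \<inter> S. r < h y))"
proof -
  have *: "eventually (\<lambda>y. r < h y) (at x within S) \<longleftrightarrow>
      (\<exists>U. open U \<and> x \<in> U \<and> (\<forall>y\<in>U \<inter> S. r < h y))" if "r < h x" for x r
    unfolding eventually_at_topological using that by (metis IntD1 IntD2 IntI)
  show ?thesis
    unfolding lsc_on_def le_Liminf_iff by (intro ball_cong refl all_cong *)
qed

lemma lsc_onE:
  assumes "lsc_on S h" "x \<in> S" "r < h x"
  obtains U where "open U" "x \<in> U" "\<forall>y\<in>U \<inter> S. r < h y"
  using assms(1)[unfolded lsc_on_iff_open, rule_format, OF assms(2,3)] by auto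

lemma lsc_on_add:
  fixes g h :: "'a::topological_space \<Rightarrow> ereal"
  assumes g: "lsc_on S g" "\<And>x. x \<in> S \<Longrightarrow> g x \<noteq> -\<infinity>"
    and h: "lsc_on S h" "\<And>x. x \<in> S \<Longrightarrow> h x \<noteq> -\<infinity>"
  shows "lsc_on S (\<lambda>x. g x + h x)"
  unfolding lsc_on_iff_open
proof (intro ballI allI impI)
  fix x r assume x: "x \<in> S" and r: "r < g x + h x"
  \<comment> \<open>A real \<open>r'\<close> between the two sides splits as
    \<open>s + (r' - s)\<close>, with \<open>s\<close> below \<open>g x\<close> and the rest below
    \<open>h x\<close>, even where \<open>r\<close> or the sum is infinite.\<close>
  obtain r' where r': "r < ereal r'" "ereal r' < g x + h x"
    using ereal_dense2[OF r] by blast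
  have "ereal r' - h x < g x"
    using r'(2) g(2)[OF x] h(2)[OF x] by (cases "g x"; cases "h x") auto
  then obtain s where s: "ereal r' - h x < ereal s" "ereal s < g x"
    using ereal_dense2 by blast
  then have t: "ereal (r' - s) < h x"
    using h(2)[OF x] by (cases "h x") auto
  obtain U where U: "open U" "x \<in> U" "\<forall>y\<in>U \<inter> S. ereal s < g y"
    by (rule lsc_onE[OF g(1) x s(2)])
  obtain V where V: "open V" "x \<in> V" "\<forall>y\<in>V \<inter> S. ereal (r' - s) < h y"
    by (rule lsc_onE[OF h(1) x t])
  have "r < g y + h y" if y: "y \<in> (U \<inter> V) \<inter> S" for y
  proof -
    have "ereal s < g y" "ereal (r' - s) < h y" using y U V by auto
    then have "ereal r' < g y + h y"
      by (cases "g y"; cases "h y") auto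
    with r'(1) show ?thesis by (rule less_trans)
  qed
  then show "\<exists>U. open U \<and> x \<in> U \<and> (\<forall>y\<in>U \<inter> S. r < g y + h y)"
    using U V by (intro exI[of _ "U \<inter> V"]) auto
qed

lemma sum_ereal_neq_MInf:
  assumes "\<And>i. i \<in> I \<Longrightarrow> f i \<noteq> (-\<infinity> :: ereal)"
  shows "sum f I \<noteq> -\<infinity>"
  using assms
  by (induction I rule: infinite_finite_induct) (auto simp: ereal_plus_eq_MInfty)

lemma lsc_on_sum:
  fixes g :: "'i \<Rightarrow> 'a::topological_space \<Rightarrow> ereal"
  assumes "finite I" "\<And>i. i \<in> I \<Longrightarrow> lsc_on S (g i)"
    and "\<And>i x. i \<in> I \<Longrightarrow> x \<in> S \<Longrightarrow> g i x \<noteq> -\<infinity>"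
  shows "lsc_on S (\<lambda>x. \<Sum>i\<in>I. g i x)"
  using assms
proof (induction I rule: finite_induct)
  case empty
  then show ?case by (auto simp: lsc_on_iff_open)
next
  case (insert i I)
  then show ?case by (auto intro!: lsc_on_add sum_ereal_neq_MInf)
qed

lemma lsc_on_compose:
  fixes h :: "'b::topological_space \<Rightarrow> ereal"
  assumes "lsc_on T h" "continuous_on UNIV p" "range p \<subseteq> T"
  shows "lsc_on UNIV (\<lambda>x. h (p x))"
  unfolding lsc_on_iff_open
proof (intro ballI allI impI)
  fix x r assume "r < h (p x)"
  moreover have "p x \<in> T" using assms(3) by auto
  ultimately obtain U where "open U" "p x \<in> U" "\<forall>y\<in>U \<inter> T. r < h y"
    using lsc_onE[OF assms(1)] by metis
  then show "\<exists>U. open U \<and> x \<in> U \<and> (\<forall>y\<in>U \<inter> UNIV. r < h (p y))"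
    using assms(2,3) by (intro exI[of _ "p -` U"]) (auto intro: open_vimage)
qed

lemma lsc_on_continuous:
  assumes "continuous_on UNIV f"
  shows "lsc_on S (\<lambda>x. ereal (f x))"
  unfolding lsc_on_iff_open
proof (intro ballI allI impI)
  fix x r assume r: "r < ereal (f x)"
  have "open ((\<lambda>x. ereal (f x)) -` {r<..})"
    by (intro open_vimage continuous_on_ereal assms open_greaterThan)
  then show "\<exists>U. open U \<and> x \<in> U \<and> (\<forall>y\<in>U \<inter> S. r < ereal (f y))"
    using r by (intro exI[of _ "(\<lambda>x. ereal (f x)) -` {r<..}"]) auto
qed

lemma lsc_on_closed_sublevel:
  assumes "lsc_on UNIV h"
  shows "closed {x. h x \<le> r}"
proof -
  have "open {x. r < h x}"
    unfolding open_subopen[of "{x. r < h x}"]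
  proof
    fix x assume "x \<in> {x. r < h x}"
    then obtain U where "open U" "x \<in> U" "\<forall>y\<in>U \<inter> UNIV. r < h y"
      using lsc_onE[OF assms, of x r] by blast
    then show "\<exists>T. open T \<and> x \<in> T \<and> T \<subseteq> {x. r < h x}" by auto
  qed
  then show ?thesis
    by (simp add: closed_def Compl_eq not_le)
qed

lemma lsc_on_subset:
  assumes "lsc_on S h" "T \<subseteq> S"
  shows "lsc_on T h"
  unfolding lsc_on_iff_open
proof (intro ballI allI impI)
  fix x r assume "x \<in> T" "r < h x"
  then show "\<exists>U. open U \<and> x \<in> U \<and> (\<forall>y\<in>U \<inter> T. r < h y)"
    using assms(2) lsc_onE[OF assms(1), of x r] by (metis IntD1 IntD2 IntI subsetD)
qed

text \<open>
  Without a minimizer, the relatively open sets \<open>{x \<in> K. h y < h x}\<close> cover \<open>K\<close>; in a finite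
  subcover the \<open>y\<close> with the least value is not covered.
\<close>

lemma lsc_on_compact_attains_inf:
  assumes "compact K" "K \<noteq> {}" "lsc_on K h"
  shows "\<exists>x. is_arg_min h (\<lambda>x. x \<in> K) x"
proof (rule ccontr)
  assume none: "\<nexists>x. is_arg_min h (\<lambda>x. x \<in> K) x"
  define V where "V y = {x \<in> K. h y < h x}" for y
  have op: "\<forall>c\<in>V ` K. openin (top_of_set K) c"
  proof
    fix c assume "c \<in> V ` K"
    then obtain y where c: "c = V y" by blast
    show "openin (top_of_set K) c"
      unfolding c openin_subopen[of _ "V y"]
      proof
        fix x assume "x \<in> V y"
        then have "x \<in> K" "h y < h x" by (auto simp: V_def)
        then obtain U where U: "open U" "x \<in> U" "\<forall>z\<in>U \<inter> K. h y < h z"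
          using lsc_onE[OF assms(3)] by metis
        then show "\<exists>T. openin (top_of_set K) T \<and> x \<in> T \<and> T \<subseteq> V y"
          using \<open>x \<in> K\<close>
          by (intro exI[of _ "K \<inter> U"]) (auto simp: V_def openin_open)
      qed
  qed
  have cov: "K \<subseteq> (\<Union>y\<in>K. V y)"
    using none unfolding is_arg_min_def V_def by blast
  have "\<exists>D\<subseteq>V ` K. finite D \<and> K \<subseteq> \<Union>D"
    by (rule \<open>compact K\<close>[unfolded compact_eq_openin_cover, rule_format, OF conjI[OF op cov]])
  then obtain D where "D \<subseteq> V ` K" "finite D" "K \<subseteq> \<Union>D" by blast
  then obtain Y where Y: "Y \<subseteq> K" "finite Y" "K \<subseteq> (\<Union>y\<in>Y. V y)"
    by (metis finite_subset_image)
  then have "Y \<noteq> {}" using \<open>K \<noteq> {}\<close> by auto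
  then obtain y where y: "is_arg_min h (\<lambda>y. y \<in> Y) y"
    using ex_is_arg_min_if_finite Y(2) by blast
  then have "y \<in> (\<Union>z\<in>Y. V z)"
    using Y unfolding is_arg_min_def by blast
  with y show False
    unfolding is_arg_min_def V_def by blast
qed

subsection \<open>Gradients of convex functions\<close>

text \<open>Riesz representation: the values of the derivative on the basis vectors are the
  components of the gradient.\<close>

lemma obtain_gradient:
  fixes f :: "'a::euclidean_space \<Rightarrow> real"
  assumes "f differentiable_on UNIV"
  obtains G where "\<And>x. GDERIV f x :> G x"
proof -
  have "\<exists>d. GDERIV f x :> d" for x
  proof -
    obtain f' where f': "(f has_derivative f') (at x)"
      using assms unfolding differentiable_on_def differentiable_def by auto
    then have lin: "linear f'"
      using has_derivative_linear by blast
    have "f' h = h \<bullet> (\<Sum>e\<in>Basis. f' e *\<^sub>R e)" for h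
    proof -
      have "f' h = f' (\<Sum>e\<in>Basis. (h \<bullet> e) *\<^sub>R e)"
        by (simp add: euclidean_representation)
      also have "\<dots> = (\<Sum>e\<in>Basis. (h \<bullet> e) * f' e)"
        by (simp add: linear_sum[OF lin] linear_scale[OF lin])
      finally show ?thesis
        by (simp add: inner_sum_right mult.commute)
    qed
    then have "f' = (\<lambda>h. h \<bullet> (\<Sum>e\<in>Basis. f' e *\<^sub>R e))" by blast
    with f' show ?thesis unfolding gderiv_def by metis
  qed
  then show thesis using that by metis
qed

text \<open>Reduction to one variable. The set \<open>S\<close> stays free because later arguments
  use both two-sided derivatives and a limit from the right.\<close>

lemma GDERIV_line:
  assumes "GDERIV f (p + t *\<^sub>R d) :> G"
  shows "((\<lambda>t. f (p + t *\<^sub>R d)) has_real_derivative (G \<bullet> d)) (at t within S)"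
proof -
  have "((\<lambda>t. p + t *\<^sub>R d) has_derivative (\<lambda>h. h *\<^sub>R d)) (at t)"
    by (auto intro!: derivative_eq_intros)
  from has_derivative_compose[OF this] assms
  have "((\<lambda>t. f (p + t *\<^sub>R d)) has_derivative (\<lambda>h. (h *\<^sub>R d) \<bullet> G)) (at t)"
    unfolding gderiv_def by blast
  then have "((\<lambda>t. f (p + t *\<^sub>R d)) has_real_derivative (G \<bullet> d)) (at t)"
    unfolding has_field_derivative_def
    by (rule has_derivative_eq_rhs) (auto simp: inner_commute mult.commute)
  then show ?thesis by (rule has_field_derivative_at_within)
qed

lemma convex_on_above_gradient:
  assumes "convex_on UNIV f" "GDERIV f p :> G"
  shows "f p + G \<bullet> d \<le> f (p + d)"
proof -
  have "convex_on UNIV (\<lambda>t. f (p + t *\<^sub>R d))"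
  proof (rule convex_onI)
    fix t x y :: real assume t: "0 < t" "t < 1"
    have "p + ((1 - t) *\<^sub>R x + t *\<^sub>R y) *\<^sub>R d =
        (1 - t) *\<^sub>R (p + x *\<^sub>R d) + t *\<^sub>R (p + y *\<^sub>R d)"
      by (simp add: algebra_simps)
    then show "f (p + ((1 - t) *\<^sub>R x + t *\<^sub>R y) *\<^sub>R d)
        \<le> (1 - t) * f (p + x *\<^sub>R d) + t * f (p + y *\<^sub>R d)"
      using convex_onD[OF assms(1), of t] t by (metis UNIV_I less_imp_le)
  qed auto
  then have "f (p + 1 *\<^sub>R d) - f (p + 0 *\<^sub>R d) \<ge> (G \<bullet> d) * (1 - 0)"
    by (rule convex_on_imp_above_tangent) (use assms(2) in \<open>auto intro!: GDERIV_line\<close>)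
  then show ?thesis by simp
qed

text \<open>The hypothesis looks only along the ray spanned by \<open>d\<close>, which is all that a
  Lipschitz condition on one block controls; \<open>K\<close> then stands for
  \<open>l * (norm d)\<^sup>2\<close>.\<close>

lemma descent_lemma:
  assumes G: "\<And>x. GDERIV f x :> G x"
    and K: "\<And>t. 0 \<le> t \<Longrightarrow> (G (p + t *\<^sub>R d) - G p) \<bullet> d \<le> t * K"
  shows "f (p + d) \<le> f p + G p \<bullet> d + K / 2"
proof -
  \<comment> \<open>Up to the constant \<open>f p\<close>, this is the gap between \<open>f\<close>
    on the segment and its quadratic upper model; \<open>K\<close> makes its derivative
    nonpositive.\<close>
  define \<psi> where "\<psi> t = f (p + t *\<^sub>R d) - t * (G p \<bullet> d) - t\<^sup>2 / 2 * K" for t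
  have "\<psi> 0 \<ge> \<psi> 1"
  proof (rule DERIV_nonpos_imp_nonincreasing[of 0 1 \<psi>])
    fix t :: real assume t: "0 \<le> t"
    have "(\<psi> has_real_derivative (G (p + t *\<^sub>R d) \<bullet> d - G p \<bullet> d - t * K)) (at t)"
      unfolding \<psi>_def by (auto intro!: derivative_eq_intros GDERIV_line G)
    with K[OF t] show "\<exists>y. (\<psi> has_real_derivative y) (at t) \<and> y \<le> 0"
      by (auto simp: inner_diff_left)
  qed auto
  then show ?thesis by (simp add: \<psi>_def)
qed

text \<open>
  Cocoercivity: minimizing the quadratic upper bound of \<open>f - G x \<bullet> _\<close> around \<open>y\<close> gives
  \<open>f y - f x - G x \<bullet> (y - x) \<ge> |G y - G x|\<^sup>2 / (2 M)\<close>; then symmetrize.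
\<close>

lemma convex_smooth_imp_lipschitz_gradient:
  assumes cvx: "convex_on UNIV f" and G: "\<And>x. GDERIV f x :> G x" and M: "0 < M"
    and smooth: "\<And>p d. f (p + d) \<le> f p + G p \<bullet> d + M / 2 * (norm d)\<^sup>2"
  shows "norm (G x - G y) \<le> M * norm (x - y)"
proof -
  have *: "(norm (G y - G x))\<^sup>2 / (2 * M) \<le> f y - f x - G x \<bullet> (y - x)" for x y
  proof -
    \<comment> \<open>The minimizer of
      \<open>(G y - G x) \<bullet> d + M / 2 * (norm d)\<^sup>2\<close>.\<close>
    define d where "d = - (1 / M) *\<^sub>R (G y - G x)"
    have nd: "norm d = norm (G y - G x) / M" using M by (simp add: d_def)
    have "f x + G x \<bullet> (y + d - x) \<le> f (x + (y + d - x))"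
      by (rule convex_on_above_gradient[OF cvx G])
    also have "\<dots> = f (y + d)" by simp
    also have "\<dots> \<le> f y + G y \<bullet> d + M / 2 * (norm d)\<^sup>2" by (rule smooth)
    finally have "f x + G x \<bullet> (y - x) \<le> f y + (G y - G x) \<bullet> d + M / 2 * (norm d)\<^sup>2"
      by (simp add: inner_simps)
    moreover have "(G y - G x) \<bullet> d = - (norm (G y - G x))\<^sup>2 / M"
      by (simp add: d_def power2_norm_eq_inner)
    moreover have "M / 2 * (norm d)\<^sup>2 = (norm (G y - G x))\<^sup>2 / (2 * M)"
      using M by (simp add: nd power_divide field_simps power2_eq_square)
    ultimately show ?thesis by (simp add: field_simps)
  qed
  have "(norm (G x - G y))\<^sup>2 / M \<le> (G x - G y) \<bullet> (x - y)"
    using *[of x y] *[of y x] by (simp add: norm_minus_commute inner_simps field_simps)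
  also have "\<dots> \<le> norm (G x - G y) * norm (x - y)" by (rule norm_cauchy_schwarz)
  finally have "norm (G x - G y) * norm (G x - G y) \<le> norm (G x - G y) * (M * norm (x - y))"
    using M by (simp add: field_simps power2_eq_square)
  then show ?thesis
    using M by (cases "G x = G y") auto
qed

subsection \<open>Proximal points\<close>

text \<open>Fermat's rule for a sum: on moving a fraction \<open>t\<close> from \<open>p\<close>
  towards \<open>z\<close>, convexity bounds the change of \<open>g\<close> by
  \<open>t * (g z - g p)\<close>; dividing by \<open>t\<close> and letting \<open>t\<close> tend to
  \<open>0\<close> from the right leaves the derivative of \<open>q\<close>. It serves both proximal
  points and minimizers of the composite objective.\<close>

lemma econvex_on_minimizer_subgradient:
  fixes g :: "'a::real_inner \<Rightarrow> ereal"
  assumes g: "econvex_on S g" "\<bar>g p\<bar> \<noteq> \<infinity>" and p: "p \<in> S"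
    and q: "GDERIV q p :> D"
    and min: "\<And>z. z \<in> S \<Longrightarrow> g p + ereal (q p) \<le> g z + ereal (q z)"
    and z: "z \<in> S"
  shows "g p + ereal (- (D \<bullet> (z - p))) \<le> g z"
proof (cases "g z = \<infinity>")
  case False
  obtain gp where gp: "g p = ereal gp" using g(2) by auto
  have "g z \<noteq> -\<infinity>" using min[OF z] gp by auto
  with False obtain gz where gz: "g z = ereal gz" by (cases "g z") auto
  let ?r = "\<lambda>t. (q (p + t *\<^sub>R (z - p)) - q (p + 0 *\<^sub>R (z - p))) / (t - 0)"
  have le: "gp - gz \<le> ?r t" if t: "0 < t" "t < 1" for t
  proof -
    let ?w = "(1 - t) *\<^sub>R p + t *\<^sub>R z"
    have w: "?w = p + t *\<^sub>R (z - p)" by (simp add: algebra_simps)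
    have "?w \<in> S"
      using g(1) p z t unfolding econvex_on_def by (auto intro: convexD)
    then have "ereal (gp + q p) \<le> g ?w + ereal (q ?w)" using min gp by fastforce
    also have "g ?w \<le> ereal (1 - t) * g p + ereal t * g z"
      using g(1) p z t unfolding econvex_on_def by force
    then have "g ?w + ereal (q ?w) \<le> ereal ((1 - t) * gp + t * gz + q ?w)"
      using gp gz by (metis add_right_mono plus_ereal.simps(1) times_ereal.simps(1))
    finally have "gp + q p \<le> (1 - t) * gp + t * gz + q ?w" by simp
    then have "t * (gp - gz) \<le> q ?w - q p" by (simp add: algebra_simps)
    with t w show ?thesis by (simp add: field_simps)
  qed
  have "((\<lambda>t. q (p + t *\<^sub>R (z - p))) has_real_derivative (D \<bullet> (z - p))) (at 0 within {0<..})"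
    using q by (intro GDERIV_line) simp
  then have "(?r \<longlongrightarrow> D \<bullet> (z - p)) (at_right 0)"
    unfolding has_field_derivative_iff .
  moreover have "eventually (\<lambda>t. gp - gz \<le> ?r t) (at_right 0)"
    using le by (auto intro!: eventually_at_rightI[of 0 1])
  ultimately have "gp - gz \<le> D \<bullet> (z - p)"
    by (intro tendsto_lowerbound[where F = "at_right 0"]) auto
  then show ?thesis using gp gz by simp
qed auto

text \<open>The affine minorant limits how fast \<open>g\<close> can fall, and the quadratic term
  outgrows it, so the search for a minimizer reduces to a compact part of \<open>S\<close>.\<close>

lemma prox_is_arg_min:
  fixes g :: "'a::euclidean_space \<Rightarrow> ereal"
  assumes S: "closed S" and proper: "proper_on S g" and lsc: "lsc_on S g" and \<gamma>: "0 < \<gamma>"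
    and minorant: "\<And>z. z \<in> S \<Longrightarrow> ereal (a + p \<bullet> z) \<le> g z"
  shows "is_arg_min (\<lambda>z. g z + ereal (1 / (2 * \<gamma>) * (norm (z - y))\<^sup>2)) (\<lambda>z. z \<in> S)
    (prox S \<gamma> g y)"
proof -
  let ?q = "\<lambda>z. 1 / (2 * \<gamma>) * (norm (z - y))\<^sup>2"
  let ?h = "\<lambda>z. g z + ereal (?q z)"
  obtain z0 where z0: "z0 \<in> S" "g z0 \<noteq> \<infinity>" "g z0 \<noteq> -\<infinity>"
    using proper unfolding proper_on_def by blast
  then obtain c where c: "?h z0 = ereal c" by (cases "g z0") auto
  \<comment> \<open>Beyond the first entry the quadratic term is at least
    \<open>(norm p + 1) * norm (z - y)\<close>, which absorbs the linear loss and leaves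
    \<open>norm (z - y)\<close>; beyond the second entry this remainder exceeds
    \<open>c - a - p \<bullet> y\<close>.\<close>
  define R where "R = max (2 * \<gamma> * (norm p + 1)) (c - a - p \<bullet> y)"
  have far: "ereal c < ?h z" if "z \<in> S" "norm (z - y) > R" for z
  proof -
    let ?r = "norm (z - y)"
    have r: "?r > 2 * \<gamma> * (norm p + 1)" "?r > c - a - p \<bullet> y"
      using that by (auto simp: R_def)
    have "2 * \<gamma> * (norm p + 1) * ?r \<le> ?r * ?r"
      using r(1) by (intro mult_right_mono) auto
    then have "(norm p + 1) * ?r \<le> ?q z"
      using \<gamma> by (simp add: field_simps power2_eq_square)
    moreover have "- (norm p * ?r) \<le> p \<bullet> (z - y)"
      using Cauchy_Schwarz_ineq2[of p "z - y"] by linarith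
    ultimately have "c < a + p \<bullet> z + ?q z"
      using r(2) by (simp add: algebra_simps)
    then have "ereal c < ereal (a + p \<bullet> z) + ereal (?q z)" by simp
    also have "\<dots> \<le> ?h z" by (intro add_right_mono minorant that)
    finally show ?thesis .
  qed
  let ?K = "S \<inter> cball y R"
  have inK: "z \<in> ?K" if "z \<in> S" "?h z \<le> ereal c" for z
    using far[OF that(1)] that by (force simp: dist_norm norm_minus_commute)
  have "lsc_on S ?h"
    using proper lsc unfolding proper_on_def
    by (intro lsc_on_add lsc_on_continuous continuous_intros) auto
  then have "lsc_on ?K ?h" by (rule lsc_on_subset) auto
  moreover have "compact ?K" using S by (intro closed_Int_compact compact_cball)
  moreover have "z0 \<in> ?K" using inK z0 c by auto
  ultimately obtain w where w: "is_arg_min ?h (\<lambda>z. z \<in> ?K) w"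
    using lsc_on_compact_attains_inf[of ?K ?h] by blast
  have "is_arg_min ?h (\<lambda>z. z \<in> S) w"
    unfolding is_arg_min_def
  proof (intro conjI notI)
    show "w \<in> S" using w unfolding is_arg_min_def by blast
    assume "\<exists>z. z \<in> S \<and> ?h z < ?h w"
    then obtain z where z: "z \<in> S" "?h z < ?h w" by blast
    have "?h w \<le> ?h z0" using w \<open>z0 \<in> ?K\<close> unfolding is_arg_min_def by (meson not_le)
    then have "?h z \<le> ereal c" using z(2) c by (metis less_imp_le order_trans)
    then have "z \<in> ?K" using inK z by blast
    then show False using w z(2) unfolding is_arg_min_def by blast
  qed
  \<comment> \<open>\<open>prox\<close> is a Hilbert choice, hence a minimizer as soon as one
    exists.\<close>
  then show ?thesis
    unfolding prox_def arg_min_on_def arg_min_def by (rule someI)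
qed

text \<open>Fermat's rule with the quadratic term, whose gradient at \<open>w\<close> is
  \<open>(1 / \<gamma>) *\<^sub>R (w - y)\<close>.\<close>

lemma prox_variational:
  fixes g :: "'a::euclidean_space \<Rightarrow> ereal" and y :: 'a
  assumes S: "closed S" and proper: "proper_on S g" and lsc: "lsc_on S g"
    and convex: "econvex_on S g" and \<gamma>: "0 < \<gamma>"
    and minorant: "\<And>z. z \<in> S \<Longrightarrow> ereal (a + p \<bullet> z) \<le> g z"
  defines "w \<equiv> prox S \<gamma> g y"
  shows "w \<in> S" and "\<bar>g w\<bar> \<noteq> \<infinity>"
    and "z \<in> S \<Longrightarrow> g w + ereal ((y - w) \<bullet> (z - w) / \<gamma>) \<le> g z"
proof -
  let ?q = "\<lambda>z. 1 / (2 * \<gamma>) * (norm (z - y))\<^sup>2"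
  have min: "is_arg_min (\<lambda>z. g z + ereal (?q z)) (\<lambda>z. z \<in> S) w"
    unfolding w_def using prox_is_arg_min[OF S proper lsc \<gamma> minorant] .
  then show w: "w \<in> S" unfolding is_arg_min_def by blast
  have le: "g w + ereal (?q w) \<le> g z + ereal (?q z)" if "z \<in> S" for z
    using min that unfolding is_arg_min_def by (meson not_le)
  obtain z0 where z0: "z0 \<in> S" "g z0 \<noteq> \<infinity>"
    using proper unfolding proper_on_def by blast
  have "g w \<noteq> \<infinity>" using le[OF z0(1)] z0(2) by (cases "g z0") auto
  then show fin: "\<bar>g w\<bar> \<noteq> \<infinity>" using proper w unfolding proper_on_def by auto
  have "GDERIV ?q w :> (1 / \<gamma>) *\<^sub>R (w - y)"
    unfolding gderiv_def power2_norm_eq_inner using \<gamma>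
    by (auto intro!: derivative_eq_intros simp: inner_commute)
  note sub = econvex_on_minimizer_subgradient[OF convex fin w this le, of z]
  have "- ((1 / \<gamma>) *\<^sub>R (w - y) \<bullet> (z - w)) = (y - w) \<bullet> (z - w) / \<gamma>"
    by (simp add: inner_diff_left diff_divide_distrib)
  with sub show "z \<in> S \<Longrightarrow> g w + ereal ((y - w) \<bullet> (z - w) / \<gamma>) \<le> g z"
    by metis
qed

subsection \<open>Blocks\<close>

lemma block_nth [simp]: "block b i x $ j = (if b j = i then x $ j else 0)"
  by (simp add: block_def)

lemma linear_block: "linear (block b i)"
  by (rule linearI) (simp_all add: vec_eq_iff)

lemmas block_add = linear_add[OF linear_block]
  and block_diff = linear_diff[OF linear_block]
  and block_scaleR = linear_scale[OF linear_block]

lemma block_in_block_space [simp]: "block b i x \<in> block_space b i"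
  by (simp add: block_space_def)

lemma block_id: "d \<in> block_space b i \<Longrightarrow> block b i d = d"
  by (auto simp: block_space_def vec_eq_iff)

lemma subspace_block_space: "subspace (block_space b i)"
  by (auto simp: block_space_def subspace_def)

lemma subst_block_eq: "subst_block b i x z = x - block b i x + block b i z"
  by (simp add: subst_block_def vec_eq_iff)

text \<open>\<open>block b i\<close> is the orthogonal projection onto
  \<open>block_space b i\<close>, hence self-adjoint.\<close>

lemma inner_block_left: "block b i u \<bullet> v = u \<bullet> block b i v"
  unfolding inner_vec_def by (intro sum.cong) auto

lemma inner_block_block: "block b i u \<bullet> block b i v = block b i u \<bullet> v"
  by (simp add: inner_block_left block_id)

lemma norm_block_le: "norm (block b i u) \<le> norm u"
  by (rule norm_le_componentwise_cart) auto

lemma sum_block: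
  assumes "\<forall>j. b j \<in> {1..m}"
  shows "(\<Sum>i=1..m. block b i u) = u"
  using assms by (simp add: vec_eq_iff)

lemma sum_inner_block:
  assumes "\<forall>j. b j \<in> {1..m}"
  shows "(\<Sum>i=1..m. block b i u \<bullet> v) = u \<bullet> v"
  by (simp add: inner_sum_left[symmetric] sum_block[OF assms] del: One_nat_def)

lemma sum_norm_block:
  assumes "\<forall>j. b j \<in> {1..m}"
  shows "(\<Sum>i=1..m. (norm (block b i u))\<^sup>2) = (norm u)\<^sup>2"
  by (simp add: power2_norm_eq_inner inner_block_block sum_inner_block[OF assms] del: One_nat_def)

lemma sweep_point_Suc: "sweep_point b (Suc i) y x = sweep_point b i y x + block b i (y - x)"
  by (auto simp: sweep_point_def vec_eq_iff less_Suc_eq)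

lemma sweep_point_first:
  assumes "\<forall>j. b j \<in> {1..m}"
  shows "sweep_point b 1 y x = x"
proof -
  have *: "(b j < 1) = False" for j using assms[rule_format, of j] by simp
  show ?thesis by (simp only: sweep_point_def * if_False vec_lambda_eta)
qed

lemma sweep_point_last:
  assumes "\<forall>j. b j \<in> {1..m}"
  shows "sweep_point b (Suc m) y x = y"
  using assms by (simp add: sweep_point_def vec_eq_iff less_Suc_eq_le)

lemma norm_minus_sweep_point_le: "norm (y - sweep_point b i y x) \<le> norm (y - x)"
  by (rule norm_le_componentwise_cart) (simp add: sweep_point_def)

lemma GDERIV_subst_block:
  assumes "GDERIV f (subst_block b i x u) :> G"
  shows "GDERIV (\<lambda>z. f (subst_block b i x z)) u :> block b i G"
proof -
  have "((\<lambda>z. subst_block b i x z) has_derivative block b i) (at u)"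
    unfolding subst_block_eq
    by (auto intro!: derivative_eq_intros bounded_linear_imp_has_derivative
        simp: linear_block linear_conv_bounded_linear[symmetric])
  from has_derivative_compose[OF this assms[unfolded gderiv_def]]
  show ?thesis unfolding gderiv_def by (simp add: inner_block_left)
qed

lemma GDERIV_unique: "GDERIV f x :> d \<Longrightarrow> GDERIV f x :> e \<Longrightarrow> d = e"
  unfolding gderiv_def
  by (metis has_derivative_unique vector_eq_ldot)

text \<open>The definite description in \<open>partial_grad\<close> is meaningful because gradients
  are unique; the chain rule through the affine block substitution identifies its value.\<close>

lemma partial_grad_eq:
  assumes "GDERIV f x :> G"
  shows "partial_grad b i f x = block b i G"
proof -
  have "subst_block b i x x = x" by (simp add: subst_block_eq)
  with assms have "GDERIV (\<lambda>z. f (subst_block b i x z)) x :> block b i G"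
    by (intro GDERIV_subst_block) simp
  then show ?thesis
    unfolding partial_grad_def by (blast intro: the_equality GDERIV_unique)
qed

text \<open>The Lipschitz condition controls only block \<open>i\<close> of the gradient difference,
  but its inner product with \<open>d\<close> sees nothing else.\<close>

lemma block_lipschitz_imp_descent:
  assumes G: "\<And>x. GDERIV f x :> G x"
    and lip: "\<forall>y. \<forall>u\<in>block_space b i. \<forall>v\<in>block_space b i.
          norm (partial_grad b i f (subst_block b i y u) - partial_grad b i f (subst_block b i y v))
            \<le> l * norm (u - v)"
    and d: "d \<in> block_space b i"
  shows "f (p + d) \<le> f p + G p \<bullet> d + l / 2 * (norm d)\<^sup>2"
proof -
  have "(G (p + t *\<^sub>R d) - G p) \<bullet> d \<le> t * (l * (norm d)\<^sup>2)" if t: "0 \<le> t" for t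
  proof -
    let ?u = "block b i p + t *\<^sub>R d"
    have "?u \<in> block_space b i"
      using d by (intro subspace_add subspace_scale subspace_block_space) auto
    moreover have "subst_block b i p ?u = p + t *\<^sub>R d" "subst_block b i p (block b i p) = p"
      by (simp_all add: subst_block_eq block_add block_scaleR block_id d)
    ultimately have "norm (block b i (G (p + t *\<^sub>R d)) - block b i (G p)) \<le> l * norm (t *\<^sub>R d)"
      using lip[rule_format, of ?u "block b i p" p] by (simp add: partial_grad_eq[OF G])
    then have *: "norm (block b i (G (p + t *\<^sub>R d) - G p)) * norm d \<le> l * norm (t *\<^sub>R d) * norm d"
      by (intro mult_right_mono) (auto simp: block_diff)
    have "(G (p + t *\<^sub>R d) - G p) \<bullet> d = block b i (G (p + t *\<^sub>R d) - G p) \<bullet> d"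
      using block_id[OF d] by (simp add: inner_block_left)
    also have "\<dots> \<le> norm (block b i (G (p + t *\<^sub>R d) - G p)) * norm d"
      by (rule norm_cauchy_schwarz)
    also note *
    finally show ?thesis using t by (simp add: power2_eq_square mult_ac)
  qed
  from descent_lemma[OF G this] show ?thesis by simp
qed

text \<open>
  The step \<open>d\<close> is the average of the \<open>m\<close> one-block steps \<open>m d_i\<close>, so convexity turns the block-wise
  quadratic upper bounds into a joint one.
\<close>

lemma block_descent_imp_descent:
  assumes blocks: "\<forall>j. b j \<in> {1..m}" and cvx: "convex_on UNIV f"
    and block_descent: "\<And>i p d. i \<in> {1..m} \<Longrightarrow> d \<in> block_space b i \<Longrightarrow>
      f (p + d) \<le> f p + G p \<bullet> d + L i / 2 * (norm d)\<^sup>2"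
    and L: "\<forall>i\<in>{1..m}. 0 < L i"
  shows "f (p + d) \<le> f p + G p \<bullet> d + (real m * (\<Sum>i=1..m. L i)) / 2 * (norm d)\<^sup>2"
proof -
  have m: "0 < m" using blocks by (metis atLeastAtMost_iff le_trans less_le_trans zero_less_one)
  have L_le: "L i \<le> (\<Sum>i=1..m. L i)" if "i \<in> {1..m}" for i
    using L that by (intro member_le_sum) (auto intro: less_imp_le)
  let ?d = "\<lambda>i. real m *\<^sub>R block b i d"
  have "(\<Sum>i=1..m. (1 / real m) *\<^sub>R (p + ?d i)) = p + d"
    using m by (simp add: scaleR_add_right sum.distrib sum_block[OF blocks] sum_constant_scaleR
        del: sum_constant One_nat_def)
  then have "f (p + d) \<le> (\<Sum>i=1..m. 1 / real m * f (p + ?d i))"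
    using convex_on_sum[of "{1..m}" UNIV f "\<lambda>_. 1 / real m" "\<lambda>i. p + ?d i"] m cvx by auto
  \<comment> \<open>The quadratic term of an \<open>m\<close>-fold step carries \<open>m\<close>
    squared and averaging divides by \<open>m\<close>; bounding each \<open>L i\<close> by the sum
    leaves \<open>m\<close> times the sum of the \<open>L i\<close>.\<close>
  also have "\<dots> \<le> (\<Sum>i=1..m. 1 / real m * f p + block b i d \<bullet> G p
      + (real m * (\<Sum>i=1..m. L i)) / 2 * (norm (block b i d))\<^sup>2)"
  proof (rule sum_mono)
    fix i assume i: "i \<in> {1..m}"
    have "?d i \<in> block_space b i" by (intro subspace_scale subspace_block_space) auto
    from block_descent[OF i this, of p]
    have "f (p + ?d i) \<le> f p + real m * (block b i d \<bullet> G p)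
        + L i / 2 * (real m)\<^sup>2 * (norm (block b i d))\<^sup>2"
      by (simp add: power_mult_distrib inner_commute)
    also have "\<dots> \<le> f p + real m * (block b i d \<bullet> G p)
        + (\<Sum>i=1..m. L i) / 2 * (real m)\<^sup>2 * (norm (block b i d))\<^sup>2"
      using L_le[OF i] by (intro add_left_mono mult_right_mono) auto
    finally show "1 / real m * f (p + ?d i) \<le> 1 / real m * f p + block b i d \<bullet> G p
        + (real m * (\<Sum>i=1..m. L i)) / 2 * (norm (block b i d))\<^sup>2"
      using m by (simp add: field_simps power2_eq_square)
  qed
  also have "\<dots> = f p + d \<bullet> G p + (real m * (\<Sum>i=1..m. L i)) / 2 * (norm d)\<^sup>2"
    unfolding sum.distrib sum_inner_block[OF blocks] sum_distrib_left[symmetric]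
      sum_norm_block[OF blocks] using m by simp
  finally show ?thesis by (simp add: inner_commute)
qed

section \<open>Finite values, minimizers and affine minorants of the composite objective\<close>

lemma sum_ereal_eq_real:
  assumes "(\<Sum>i\<in>I. f i) \<noteq> \<infinity>" "finite I" "\<And>i. i \<in> I \<Longrightarrow> f i \<noteq> (-\<infinity> :: ereal)"
  shows "i \<in> I \<Longrightarrow> \<bar>f i\<bar> \<noteq> \<infinity>"
    and "(\<Sum>i\<in>I. f i) = ereal (\<Sum>i\<in>I. real_of_ereal (f i))"
proof -
  show fin: "\<bar>f i\<bar> \<noteq> \<infinity>" if "i \<in> I" for i
    using assms that by (auto simp: sum_Pinfty)
  have "(\<Sum>i\<in>I. f i) = (\<Sum>i\<in>I. ereal (real_of_ereal (f i)))"
    using fin by (intro sum.cong) (auto simp: ereal_real)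
  then show "(\<Sum>i\<in>I. f i) = ereal (\<Sum>i\<in>I. real_of_ereal (f i))" by simp
qed

text \<open>Written as a sublevel set so that lower semicontinuity gives closedness
  directly.\<close>

lemma argmin_set_eq_sublevel: "argmin_set F = {x. F x \<le> min_val F}"
  by (simp add: argmin_set_def is_arg_min_def min_val_def le_INF_iff not_less)

lemma argmin_set_eq: "argmin_set F = {x. F x = min_val F}"
proof -
  have "min_val F \<le> F x" for x unfolding min_val_def by (rule INF_lower) simp
  then show ?thesis unfolding argmin_set_eq_sublevel by (simp add: eq_iff)
qed

lemma closed_argmin_composite:
  assumes f: "continuous_on UNIV f"
    and g: "\<forall>i\<in>{1..m}. proper_on (block_space b i) (g i)"
      "\<forall>i\<in>{1..m}. lsc_on (block_space b i) (g i)"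
  shows "closed (argmin_set (composite b m f g))"
proof -
  have "continuous_on UNIV (block b i)" for i
    by (rule linear_continuous_on) (simp add: linear_block linear_conv_bounded_linear[symmetric])
  then have "lsc_on UNIV (composite b m f g)"
    unfolding composite_def using f g
    by (intro lsc_on_add lsc_on_continuous lsc_on_sum sum_ereal_neq_MInf
        lsc_on_compose[where T = "block_space b i" for i])
      (auto simp: proper_on_def)
  then show ?thesis
    unfolding argmin_set_eq_sublevel by (rule lsc_on_closed_sublevel)
qed

lemma composite_eq_real:
  assumes "composite b m f g x \<noteq> \<infinity>" "\<forall>i\<in>{1..m}. proper_on (block_space b i) (g i)"
  shows "i \<in> {1..m} \<Longrightarrow> \<bar>g i (block b i x)\<bar> \<noteq> \<infinity>"
    and "composite b m f g x = ereal (f x + (\<Sum>i=1..m. real_of_ereal (g i (block b i x))))"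
proof -
  have "(\<Sum>i=1..m. g i (block b i x)) \<noteq> \<infinity>"
    using assms(1) by (auto simp: composite_def)
  note * = sum_ereal_eq_real[OF this]
  show "i \<in> {1..m} \<Longrightarrow> \<bar>g i (block b i x)\<bar> \<noteq> \<infinity>"
    using assms(2) by (intro *(1)) (auto simp: proper_on_def)
  have "(\<Sum>i=1..m. g i (block b i x)) = ereal (\<Sum>i=1..m. real_of_ereal (g i (block b i x)))"
    using assms(2) by (intro *(2)) (auto simp: proper_on_def)
  then show "composite b m f g x = ereal (f x + (\<Sum>i=1..m. real_of_ereal (g i (block b i x))))"
    by (simp add: composite_def)
qed

lemma block_subst_block:
  "block b l (subst_block b i x z) = (if l = i then block b i z else block b l x)"
  by (cases "l = i") (auto simp: vec_eq_iff subst_block_def)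

text \<open>With the other blocks frozen at \<open>zs\<close>, block \<open>i\<close> of
  \<open>zs\<close> minimizes \<open>g i\<close> plus a differentiable function, so Fermat's rule
  applies. The resulting minorant is what makes proximal points exist.\<close>

lemma composite_minimizer_affine_minorant:
  assumes G: "GDERIV f zs :> G"
    and proper: "\<forall>i\<in>{1..m}. proper_on (block_space b i) (g i)"
    and convex: "\<forall>i\<in>{1..m}. econvex_on (block_space b i) (g i)"
    and min: "\<And>z. composite b m f g zs \<le> composite b m f g z"
    and fin: "composite b m f g zs \<noteq> \<infinity>"
    and i: "i \<in> {1..m}" and z: "z \<in> block_space b i"
  shows "g i (block b i zs) + ereal (- (G \<bullet> (z - block b i zs))) \<le> g i z"
proof -
  let ?p = "block b i zs" and ?q = "\<lambda>z. f (subst_block b i zs z)"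
  note real = composite_eq_real[OF fin proper]
  define s where "s = (\<Sum>l\<in>{1..m} - {i}. real_of_ereal (g l (block b l zs)))"
  have split: "composite b m f g (subst_block b i zs z) = g i z + ereal (?q z) + ereal s"
    if "z \<in> block_space b i" for z
  proof -
    have "(\<Sum>l\<in>{1..m} - {i}. g l (block b l zs)) = ereal s"
      unfolding s_def sum_ereal[symmetric]
      using real(1) by (intro sum.cong) (auto simp: ereal_real)
    moreover have "(\<Sum>l=1..m. g l (block b l (subst_block b i zs z)))
        = g i z + (\<Sum>l\<in>{1..m} - {i}. g l (block b l zs))"
      using i that
      by (subst sum.remove[of _ i]) (auto simp: block_subst_block block_id intro!: sum.cong)
    ultimately show ?thesis by (simp add: composite_def ac_simps)
  qed
  have self: "subst_block b i zs ?p = zs" by (simp add: subst_block_eq block_id)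
  have "GDERIV ?q ?p :> block b i G"
    using G by (intro GDERIV_subst_block) (simp add: self)
  moreover have "g i ?p + ereal (?q ?p) \<le> g i z + ereal (?q z)" if "z \<in> block_space b i" for z
    using min[of "subst_block b i zs z"] split[OF that] split[of ?p] self
    by (cases "g i ?p"; cases "g i z") auto
  ultimately have "g i ?p + ereal (- (block b i G \<bullet> (z - ?p))) \<le> g i z"
    using convex real(1) i z by (intro econvex_on_minimizer_subgradient) auto
  moreover have "block b i G \<bullet> (z - ?p) = G \<bullet> (z - ?p)"
    using z by (simp add: inner_block_left block_diff block_id)
  ultimately show ?thesis by simp
qed

subsection \<open>Elementary estimates\<close>

text \<open>One block update: \<open>d\<close> is the new step, \<open>e\<close> the previous one,
  \<open>n\<close> the partial gradient. Young's inequality splits the inertial product evenly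
  between \<open>d\<close> and \<open>e\<close>; the choice of \<open>\<gamma>\<close> leaves
  \<open>d\<close> the same weight \<open>\<beta> / (2 * \<gamma>)\<close> as \<open>e\<close>, plus
  a margin that is positive when \<open>c < 1\<close>.\<close>

lemma inertial_step_decrease:
  fixes d e n :: "'a::real_inner" and \<beta> \<gamma> c l :: real
  assumes variational: "gp + ((- d - \<gamma> *\<^sub>R n + \<beta> *\<^sub>R e) \<bullet> (- d)) / \<gamma> \<le> gx"
    and descent: "fp \<le> fx + n \<bullet> d + l / 2 * (norm d)\<^sup>2"
    and \<gamma>: "\<gamma> = 2 * (1 - \<beta>) * c / l"
    and ranges: "0 \<le> \<beta>" "\<beta> < 1" "0 < c" "0 < l"
  shows "fp + gp + (\<beta> / (2 * \<gamma>) + l * (1 - c) / (2 * c)) * (norm d)\<^sup>2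
    \<le> fx + gx + \<beta> / (2 * \<gamma>) * (norm e)\<^sup>2"
proof -
  have pos: "0 < \<gamma>" using ranges by (simp add: \<gamma>)
  have "0 \<le> (d - e) \<bullet> (d - e)" by simp
  then have "2 * (e \<bullet> d) \<le> (norm d)\<^sup>2 + (norm e)\<^sup>2"
    by (simp add: power2_norm_eq_inner inner_diff_left inner_diff_right inner_commute)
  then have "\<beta> / (2 * \<gamma>) * (2 * (e \<bullet> d)) \<le> \<beta> / (2 * \<gamma>) * ((norm d)\<^sup>2 + (norm e)\<^sup>2)"
    using pos ranges by (intro mult_left_mono) auto
  then have young: "\<beta> / \<gamma> * (e \<bullet> d) \<le> \<beta> / (2 * \<gamma>) * (norm d)\<^sup>2 + \<beta> / (2 * \<gamma>) * (norm e)\<^sup>2"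
    by (simp add: algebra_simps)
  have "(- d - \<gamma> *\<^sub>R n + \<beta> *\<^sub>R e) \<bullet> (- d) = (norm d)\<^sup>2 + \<gamma> * (n \<bullet> d) - \<beta> * (e \<bullet> d)"
    by (simp add: power2_norm_eq_inner inner_diff_left inner_add_left)
  then have "((- d - \<gamma> *\<^sub>R n + \<beta> *\<^sub>R e) \<bullet> (- d)) / \<gamma> = 1 / \<gamma> * (norm d)\<^sup>2 + n \<bullet> d - \<beta> / \<gamma> * (e \<bullet> d)"
    using pos by (simp add: field_simps)
  moreover have "1 / \<gamma> - l / 2 - \<beta> / (2 * \<gamma>) = \<beta> / (2 * \<gamma>) + l * (1 - c) / (2 * c)"
  proof -
    have "(1 - \<beta>) / \<gamma> = l / (2 * c)" using ranges by (simp add: \<gamma> field_simps)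
    moreover have "l * (1 - c) / (2 * c) = l / (2 * c) - l / 2" using ranges by (simp add: field_simps)
    moreover have "1 / \<gamma> = (1 - \<beta>) / \<gamma> + 2 * (\<beta> / (2 * \<gamma>))" using pos by (simp add: field_simps)
    ultimately show ?thesis by linarith
  qed
  then have "(1 / \<gamma> - l / 2 - \<beta> / (2 * \<gamma>)) * (norm d)\<^sup>2
      = (\<beta> / (2 * \<gamma>) + l * (1 - c) / (2 * c)) * (norm d)\<^sup>2"
    by simp
  then have "1 / \<gamma> * (norm d)\<^sup>2 - l / 2 * (norm d)\<^sup>2 - \<beta> / (2 * \<gamma>) * (norm d)\<^sup>2
      = (\<beta> / (2 * \<gamma>) + l * (1 - c) / (2 * c)) * (norm d)\<^sup>2"
    by (simp add: left_diff_distrib)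
  ultimately show ?thesis using variational descent young by linarith
qed

text \<open>Growth bounds \<open>s\<close> by the square root of \<open>r / \<nu>\<close>; squaring
  the last hypothesis and cancelling one factor \<open>r\<close> gives the claim.\<close>

lemma quadratic_growth_bound:
  fixes r s D K \<nu> :: real
  assumes "0 < \<nu>" "\<nu> * s\<^sup>2 \<le> r" "r \<le> K * D * s"
  shows "r \<le> K\<^sup>2 / \<nu> * D\<^sup>2"
proof (cases "r = 0")
  case False
  have r: "0 < r"
    using False assms(1,2) by (metis less_eq_real_def mult_nonneg_nonneg order_trans zero_le_power2)
  have "r * r \<le> (K * D * s) * (K * D * s)"
    using assms(3) r by (intro mult_mono) auto
  also have "\<dots> = K\<^sup>2 * D\<^sup>2 * s\<^sup>2" by (simp add: power2_eq_square)
  also have "\<dots> \<le> K\<^sup>2 * D\<^sup>2 * (r / \<nu>)"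
    using assms(1,2) by (intro mult_left_mono) (auto simp: field_simps)
  finally have "r * r \<le> r * (K\<^sup>2 / \<nu> * D\<^sup>2)" by (simp add: field_simps)
  then show ?thesis using mult_le_cancel_left_pos[OF r] by blast
next
  case True
  then show ?thesis using assms(1) by simp
qed

lemma frac_1_minus_mono:
  fixes s t :: real
  assumes "s \<le> t" "t < 1"
  shows "s / (1 - s) \<le> t / (1 - t)"
proof -
  have "1 / (1 - s) \<le> 1 / (1 - t)" using assms by (intro frac_le) auto
  moreover have "s / (1 - s) = 1 / (1 - s) - 1" "t / (1 - t) = 1 / (1 - t) - 1"
    using assms by (simp_all add: field_simps)
  ultimately show ?thesis by linarith
qed

text \<open>Even and odd offsets decay separately, so the induction carries two consecutive indices
  and \<open>A\<close> covers both starting values.\<close>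

lemma two_step_contraction_bigo:
  fixes \<xi> :: "nat \<Rightarrow> real"
  assumes nonneg: "\<And>k. K \<le> k \<Longrightarrow> 0 \<le> \<xi> k"
    and step: "\<And>k. K \<le> k \<Longrightarrow> \<xi> (k + 2) \<le> q * \<xi> k"
    and q: "0 < q"
  shows "\<xi> \<in> O(\<lambda>k. sqrt q ^ k)"
proof -
  define A where "A = max (\<xi> K / sqrt q ^ K) (\<xi> (Suc K) / sqrt q ^ Suc K)"
  have "\<xi> (K + n) \<le> A * sqrt q ^ (K + n) \<and> \<xi> (K + Suc n) \<le> A * sqrt q ^ (K + Suc n)" for n
  proof (induction n)
    case 0
    have "\<xi> K / sqrt q ^ K \<le> A" "\<xi> (Suc K) / sqrt q ^ Suc K \<le> A" by (auto simp: A_def)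
    then show ?case using q by (simp add: divide_le_eq del: power_Suc)
  next
    case (Suc n)
    have "\<xi> (K + n + 2) \<le> q * \<xi> (K + n)" by (rule step) simp
    also have "\<dots> \<le> q * (A * sqrt q ^ (K + n))" using Suc q by (intro mult_left_mono) auto
    also have "\<dots> = A * sqrt q ^ (K + n + 2)" using q by (simp add: power_add)
    finally show ?case using Suc by simp
  qed
  then have "\<xi> k \<le> A * sqrt q ^ k" if "K \<le> k" for k
    using that le_Suc_ex by blast
  then have "eventually (\<lambda>k. norm (\<xi> k) \<le> A * norm (sqrt q ^ k)) sequentially"
    using nonneg q by (auto simp: eventually_sequentially intro!: exI[of _ K])
  then show ?thesis by (rule bigoI)
qed

subsection \<open>The inertial block proximal gradient method\<close>

locale inertial_block_prox =
  fixes m :: nat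
    and b :: "'n::finite \<Rightarrow> nat"
    and f :: "real ^ 'n \<Rightarrow> real"
    and G :: "real ^ 'n \<Rightarrow> real ^ 'n"
    and g :: "nat \<Rightarrow> real ^ 'n \<Rightarrow> ereal"
    and L :: "nat \<Rightarrow> real"
    and F :: "real ^ 'n \<Rightarrow> ereal"
    and \<nu> c \<beta>hi :: real
    and \<beta> \<gamma> :: "nat \<Rightarrow> nat \<Rightarrow> real"
    and x :: "nat \<Rightarrow> real ^ 'n"
  assumes blocks: "\<forall>j. b j \<in> {1..m}"
    and f_convex: "convex_on UNIV f"
    and gradient: "GDERIV f z :> G z"
    and L_pos: "\<forall>i\<in>{1..m}. 0 < L i"
    and L_lipschitz: "\<forall>i\<in>{1..m}. \<forall>y. \<forall>u\<in>block_space b i. \<forall>v\<in>block_space b i.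
          norm (partial_grad b i f (subst_block b i y u) - partial_grad b i f (subst_block b i y v))
            \<le> L i * norm (u - v)"
    and g_proper: "\<forall>i\<in>{1..m}. proper_on (block_space b i) (g i)"
    and g_lsc: "\<forall>i\<in>{1..m}. lsc_on (block_space b i) (g i)"
    and g_convex: "\<forall>i\<in>{1..m}. econvex_on (block_space b i) (g i)"
    and F_eq: "F = composite b m f g"
    and min_attained: "argmin_set F \<noteq> {}"
    and min_finite: "\<bar>min_val F\<bar> \<noteq> \<infinity>"
    and \<nu>_pos: "0 < \<nu>"
    and growth: "\<forall>y. F y - min_val F \<ge> ereal (\<nu> * (norm (y - closest_point (argmin_set F) y))\<^sup>2)"
    and \<beta>_range: "\<forall>k. \<forall>i\<in>{1..m}. \<beta> k i \<in> {0..<1}"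
    and \<beta>_decreasing: "\<forall>i\<in>{1..m}. decseq (\<lambda>k. \<beta> k i)"
    and \<beta>_le: "\<forall>k. \<forall>i\<in>{1..m}. \<beta> k i \<le> \<beta>hi"
    and \<beta>hi_less: "\<beta>hi < 1"
    and c_range: "0 < c" "c < 1"
    and \<gamma>_eq: "\<forall>k. \<forall>i\<in>{1..m}. \<gamma> k i = 2 * (1 - \<beta> k i) * c / L i"
    and scheme: "\<forall>k\<ge>1. \<forall>i\<in>{1..m}.
          block b i (x (k + 1)) =
            prox (block_space b i) (\<gamma> k i) (g i)
              (block b i (x k)
                - \<gamma> k i *\<^sub>R partial_grad b i f (sweep_point b i (x (k + 1)) (x k))
                + \<beta> k i *\<^sub>R (block b i (x k) - block b i (x (k - 1))))"
begin

text \<open>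
  As \<open>real_of_ereal \<infinity> = 0\<close>, \<open>F_val\<close> agrees with \<open>F\<close> only where \<open>F\<close> is finite.  That is the case for all
  iterates from \<open>x 2\<close> on, while \<open>F (x 0)\<close> and \<open>F (x 1)\<close> may be infinite.
\<close>

definition Fmin :: real where "Fmin = real_of_ereal (min_val F)"

definition g_val :: "nat \<Rightarrow> real ^ 'n \<Rightarrow> real" where
  "g_val i z = real_of_ereal (g i (block b i z))"

definition F_val :: "real ^ 'n \<Rightarrow> real" where
  "F_val z = f z + (\<Sum>i=1..m. g_val i z)"

definition D :: "nat \<Rightarrow> real ^ 'n" where "D k = x (Suc k) - x k"

definition W :: "nat \<Rightarrow> nat \<Rightarrow> real ^ 'n" where
  "W k i = sweep_point b i (x (Suc k)) (x k)"

definition \<delta> :: "nat \<Rightarrow> nat \<Rightarrow> real" where "\<delta> k i = \<beta> k i / (2 * \<gamma> k i)"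

text \<open>The weight is \<delta> at \<open>Suc k\<close> because the following sweep charges
  \<open>D k\<close> with exactly that coefficient.\<close>

definition \<xi> :: "nat \<Rightarrow> real" where
  "\<xi> k = F_val (x (Suc k)) - Fmin + (\<Sum>i=1..m. \<delta> (Suc k) i * (norm (block b i (D k)))\<^sup>2)"

text \<open>The constant of the joint quadratic upper bound, and thus a Lipschitz constant of the
  full gradient.\<close>

definition M :: real where "M = real m * (\<Sum>i=1..m. L i)"

text \<open>A bound, uniform in \<open>k\<close> and \<open>i\<close>, for
  \<open>1 / \<gamma> k i\<close> and also for \<open>\<delta> k i\<close>.\<close>

definition B :: real where "B = (\<Sum>i=1..m. L i) / (2 * (1 - \<beta>hi) * c)"

lemma m_pos: "1 \<le> m"
  using blocks[rule_format, of undefined] by simp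

lemma L_le_sum: "i \<in> {1..m} \<Longrightarrow> L i \<le> (\<Sum>i=1..m. L i)"
  using L_pos by (intro member_le_sum) (auto intro: less_imp_le)

lemma sum_L_pos: "0 < (\<Sum>i=1..m. L i)"
  using L_pos m_pos by (intro sum_pos) auto

lemma M_pos: "0 < M"
  using m_pos sum_L_pos unfolding M_def by simp

lemma block_descent:
  assumes "i \<in> {1..m}" "d \<in> block_space b i"
  shows "f (p + d) \<le> f p + G p \<bullet> d + L i / 2 * (norm d)\<^sup>2"
  by (rule block_lipschitz_imp_descent[OF gradient bspec[OF L_lipschitz assms(1)] assms(2)])

lemma gradient_lipschitz: "norm (G u - G v) \<le> M * norm (u - v)"
  by (rule convex_smooth_imp_lipschitz_gradient[OF f_convex gradient M_pos])
    (use block_descent_imp_descent[OF blocks f_convex block_descent L_pos] in \<open>simp add: M_def\<close>)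

lemma \<gamma>_pos: "i \<in> {1..m} \<Longrightarrow> 0 < \<gamma> k i"
  using \<gamma>_eq \<beta>_range c_range L_pos by simp

lemma \<delta>_nonneg: "i \<in> {1..m} \<Longrightarrow> 0 \<le> \<delta> k i"
  using \<gamma>_pos[of i k] \<beta>_range by (simp add: \<delta>_def)

text \<open>Eliminating \<gamma> shows \<delta> as an increasing function of \<beta>, so it inherits
  the monotonicity of \<beta> in \<open>k\<close>.\<close>

lemma \<delta>_eq:
  assumes i: "i \<in> {1..m}"
  shows "\<delta> k i = L i / (4 * c) * (\<beta> k i / (1 - \<beta> k i))"
  unfolding \<delta>_def \<gamma>_eq[rule_format, OF i]
  by (simp add: mult_ac del: right_diff_distrib_numeral left_diff_distrib_numeral)

lemma \<delta>_Suc_le: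
  assumes i: "i \<in> {1..m}"
  shows "\<delta> (Suc k) i \<le> \<delta> k i"
proof -
  have "\<beta> (Suc k) i \<le> \<beta> k i" "\<beta> k i < 1"
    using \<beta>_decreasing \<beta>_range i by (auto intro: decseq_SucD)
  then show ?thesis
    using L_pos c_range i unfolding \<delta>_eq[OF i]
    by (intro mult_left_mono frac_1_minus_mono) (auto intro: less_imp_le)
qed

lemma inverse_\<gamma>_le:
  assumes i: "i \<in> {1..m}"
  shows "1 / \<gamma> k i \<le> B"
proof -
  have \<beta>: "\<beta> k i \<le> \<beta>hi" "\<beta> k i < 1" using \<beta>_le \<beta>_range i by auto
  have "1 / \<gamma> k i = L i / (2 * (1 - \<beta> k i) * c)"
    using \<gamma>_eq i by simp
  also have "\<dots> \<le> (\<Sum>i=1..m. L i) / (2 * (1 - \<beta>hi) * c)"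
    using \<beta> \<beta>hi_less c_range L_le_sum[OF i] sum_L_pos by (intro frac_le mult_right_mono) auto
  finally show ?thesis by (simp add: B_def)
qed

lemma B_pos: "0 < B"
  using sum_L_pos \<beta>hi_less c_range by (simp add: B_def)

lemma \<delta>_le:
  assumes i: "i \<in> {1..m}"
  shows "\<delta> k i \<le> B"
proof -
  have "\<beta> k i / 2 * (1 / \<gamma> k i) \<le> 1 * B"
  proof (rule mult_mono)
    show "\<beta> k i / 2 \<le> 1" using \<beta>_range[rule_format, OF i, of k] by simp
  qed (use inverse_\<gamma>_le[OF i] \<gamma>_pos[OF i, of k] in auto)
  then show ?thesis by (simp add: \<delta>_def)
qed

section \<open>Finite values and a nearby minimizer\<close>

lemma min_val_eq: "min_val F = ereal Fmin"
  using min_finite by (simp add: Fmin_def ereal_real)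

lemma min_le: "min_val F \<le> F z"
  unfolding min_val_def by (rule INF_lower) simp

lemma F_eq_val:
  assumes "F z \<noteq> \<infinity>"
  shows "F z = ereal (F_val z)" and "i \<in> {1..m} \<Longrightarrow> g i (block b i z) = ereal (g_val i z)"
  using composite_eq_real[of b m f g z] assms g_proper
  by (simp_all add: F_eq F_val_def g_val_def ereal_real)

text \<open>
  \<open>closest_point\<close> is a junk value unless the set is closed, which is why lower semicontinuity of \<open>F\<close> is
  needed here.
\<close>

lemma obtain_near_minimizer:
  obtains z where "F z = ereal Fmin" "ereal (\<nu> * (norm (y - z))\<^sup>2) \<le> F y - ereal Fmin"
proof -
  have "closed (argmin_set F)"
    unfolding F_eq
  proof (rule closed_argmin_composite[OF _ g_proper g_lsc])
    show "continuous_on UNIV f"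
      using gradient unfolding gderiv_def
      by (auto intro!: continuous_at_imp_continuous_on has_derivative_continuous)
  qed
  then have "closest_point (argmin_set F) y \<in> argmin_set F"
    using min_attained by (rule closest_point_in_set)
  then show thesis
    using that[of "closest_point (argmin_set F) y"] growth
    by (simp add: argmin_set_eq min_val_eq)
qed

lemma g_affine_minorant:
  assumes i: "i \<in> {1..m}"
  obtains a p where "\<And>z. z \<in> block_space b i \<Longrightarrow> ereal (a + p \<bullet> z) \<le> g i z"
proof -
  obtain zs where zs: "F zs = ereal Fmin" using obtain_near_minimizer by metis
  have "ereal (g_val i zs + G zs \<bullet> block b i zs + (- G zs) \<bullet> z) \<le> g i z"
    if z: "z \<in> block_space b i" for z
  proof -
    have "composite b m f g zs \<le> composite b m f g y" for y
      using zs min_le[of y] min_val_eq unfolding F_eq by metis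
    moreover have "composite b m f g zs \<noteq> \<infinity>"
      using zs unfolding F_eq by (metis ereal.simps(2) infinity_ereal_def)
    ultimately have "g i (block b i zs) + ereal (- (G zs \<bullet> (z - block b i zs))) \<le> g i z"
      by (rule composite_minimizer_affine_minorant[OF gradient g_proper g_convex _ _ i z])
    moreover have "g i (block b i zs) = ereal (g_val i zs)"
      using F_eq_val(2)[of zs] zs i by simp
    ultimately show ?thesis by (simp add: inner_diff_right algebra_simps)
  qed
  then show thesis using that by blast
qed

section \<open>Proximal steps of the iteration\<close>

lemma prox_step:
  assumes k: "1 \<le> k" and i: "i \<in> {1..m}"
  shows "\<bar>g i (block b i (x (Suc k)))\<bar> \<noteq> \<infinity>"
    and "z \<in> block_space b i \<Longrightarrow> g i (block b i (x (Suc k)))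
      + ereal ((- block b i (D k) - \<gamma> k i *\<^sub>R block b i (G (W k i))
        + \<beta> k i *\<^sub>R block b i (D (k - 1))) \<bullet> (z - block b i (x (Suc k))) / \<gamma> k i) \<le> g i z"
proof -
  obtain a p where minorant: "\<And>z. z \<in> block_space b i \<Longrightarrow> ereal (a + p \<bullet> z) \<le> g i z"
    using g_affine_minorant[OF i] by blast
  define y where "y = block b i (x k) - \<gamma> k i *\<^sub>R block b i (G (W k i))
    + \<beta> k i *\<^sub>R (block b i (x k) - block b i (x (k - 1)))"
  have w: "prox (block_space b i) (\<gamma> k i) (g i) y = block b i (x (Suc k))"
    using scheme k i by (simp add: y_def W_def partial_grad_eq[OF gradient])
  note variational = prox_variational[where y = y and \<gamma> = "\<gamma> k i", OF closed_subspace[OF subspace_block_space] bspec[OF g_proper i]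
    bspec[OF g_lsc i] bspec[OF g_convex i] \<gamma>_pos[OF i] minorant, unfolded w]
  show "\<bar>g i (block b i (x (Suc k)))\<bar> \<noteq> \<infinity>" by (rule variational)
  have "x k - x (k - 1) = D (k - 1)" using k by (simp add: D_def)
  then have "y - block b i (x (Suc k)) = - block b i (D k) - \<gamma> k i *\<^sub>R block b i (G (W k i))
      + \<beta> k i *\<^sub>R block b i (D (k - 1))"
    unfolding y_def by (simp add: D_def[of k] block_diff[symmetric]) (simp add: block_diff)
  with variational(3)[of z] show "z \<in> block_space b i \<Longrightarrow> g i (block b i (x (Suc k)))
      + ereal ((- block b i (D k) - \<gamma> k i *\<^sub>R block b i (G (W k i))
        + \<beta> k i *\<^sub>R block b i (D (k - 1))) \<bullet> (z - block b i (x (Suc k))) / \<gamma> k i) \<le> g i z"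
    by simp
qed

lemma F_finite:
  assumes "1 \<le> k"
  shows "F (x (Suc k)) \<noteq> \<infinity>"
proof -
  have "g i (block b i (x (Suc k))) \<noteq> \<infinity>" if "i \<in> {1..m}" for i
    using prox_step(1)[OF assms that] by auto
  then show ?thesis by (simp add: F_eq composite_def sum_Pinfty)
qed

lemma F_val_ge:
  assumes "1 \<le> k"
  shows "Fmin \<le> F_val (x (Suc k))"
  using min_le[of "x (Suc k)"] F_eq_val(1)[OF F_finite[OF assms]] by (simp add: min_val_eq)

lemma prox_step_val:
  assumes k: "1 \<le> k" and i: "i \<in> {1..m}" and z: "F z \<noteq> \<infinity>"
  shows "g_val i (x (Suc k)) + (- block b i (D k) - \<gamma> k i *\<^sub>R block b i (G (W k i))
        + \<beta> k i *\<^sub>R block b i (D (k - 1))) \<bullet> block b i (z - x (Suc k)) / \<gamma> k i \<le> g_val i z"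
  using prox_step(2)[OF k i, of "block b i z"] F_eq_val(2)[OF z i] F_eq_val(2)[OF F_finite[OF k] i]
  by (simp add: block_diff)

section \<open>Decrease of the energy \<xi> over one sweep\<close>

lemma \<xi>_decrease:
  assumes k: "1 \<le> k" and a: "\<And>i. i \<in> {1..m} \<Longrightarrow> a \<le> L i * (1 - c) / (2 * c)"
  shows "\<xi> (Suc k) + a * (norm (D (Suc k)))\<^sup>2 \<le> \<xi> k"
proof -
  let ?d = "\<lambda>i. block b i (D (Suc k))" and ?e = "\<lambda>i. block b i (D k)"
  \<comment> \<open>The variational inequality is tested at the previous iterate
    \<open>x (Suc k)\<close>, where \<open>F\<close> is finite since
    \<open>1 \<le> k\<close>.\<close>
  have step: "f (W (Suc k) (Suc i)) - f (W (Suc k) i) + (g_val i (x (Suc (Suc k))) - g_val i (x (Suc k)))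
      + \<delta> (Suc (Suc k)) i * (norm (?d i))\<^sup>2 + a * (norm (?d i))\<^sup>2
      \<le> \<delta> (Suc k) i * (norm (?e i))\<^sup>2" if i: "i \<in> {1..m}" for i
  proof -
    let ?n = "block b i (G (W (Suc k) i))"
    have "block b i (x (Suc k) - x (Suc (Suc k))) = - ?d i"
      by (simp add: D_def block_diff)
    with prox_step_val[of "Suc k" i "x (Suc k)"] i F_finite[OF k]
    have variational: "g_val i (x (Suc (Suc k))) + (- ?d i - \<gamma> (Suc k) i *\<^sub>R ?n + \<beta> (Suc k) i *\<^sub>R ?e i)
        \<bullet> (- ?d i) / \<gamma> (Suc k) i \<le> g_val i (x (Suc k))"
      by simp
    have "W (Suc k) (Suc i) = W (Suc k) i + ?d i"
      by (simp add: W_def D_def sweep_point_Suc)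
    moreover have "G (W (Suc k) i) \<bullet> ?d i = ?n \<bullet> ?d i"
      by (simp add: inner_block_left block_id)
    ultimately have descent: "f (W (Suc k) (Suc i)) \<le> f (W (Suc k) i) + ?n \<bullet> ?d i + L i / 2 * (norm (?d i))\<^sup>2"
      using block_descent[OF i, of "?d i" "W (Suc k) i"] by simp
    have ineq: "f (W (Suc k) (Suc i)) + g_val i (x (Suc (Suc k)))
        + (\<delta> (Suc k) i + L i * (1 - c) / (2 * c)) * (norm (?d i))\<^sup>2
        \<le> f (W (Suc k) i) + g_val i (x (Suc k)) + \<delta> (Suc k) i * (norm (?e i))\<^sup>2"
      unfolding \<delta>_def
      by (rule inertial_step_decrease[OF variational descent])
        (use \<gamma>_eq \<beta>_range c_range L_pos i in auto)
    \<comment> \<open>As \<delta> is non-increasing, the weight of the new step may be lowered to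
      the one used by the next energy.\<close>
    have "(\<delta> (Suc (Suc k)) i + a) * (norm (?d i))\<^sup>2
        \<le> (\<delta> (Suc k) i + L i * (1 - c) / (2 * c)) * (norm (?d i))\<^sup>2"
      using \<delta>_Suc_le[OF i] a[OF i] by (intro mult_right_mono add_mono) auto
    with ineq show ?thesis by (simp add: distrib_right)
  qed
  \<comment> \<open>Consecutive sweep points differ in one block, so the block-wise changes of
    \<open>f\<close> telescope from the old iterate to the new one.\<close>
  have "(\<Sum>i=1..m. f (W (Suc k) (Suc i)) - f (W (Suc k) i)) = f (W (Suc k) (Suc m)) - f (W (Suc k) 1)"
    using m_pos by (intro sum_Suc_diff) simp
  also have "\<dots> = f (x (Suc (Suc k))) - f (x (Suc k))"
    unfolding W_def sweep_point_first[OF blocks] sweep_point_last[OF blocks] ..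
  finally have tele: "(\<Sum>i=1..m. f (W (Suc k) (Suc i)) - f (W (Suc k) i))
      = f (x (Suc (Suc k))) - f (x (Suc k))" .
  have "(\<Sum>i=1..m. f (W (Suc k) (Suc i)) - f (W (Suc k) i)
        + (g_val i (x (Suc (Suc k))) - g_val i (x (Suc k)))
        + \<delta> (Suc (Suc k)) i * (norm (?d i))\<^sup>2 + a * (norm (?d i))\<^sup>2)
      \<le> (\<Sum>i=1..m. \<delta> (Suc k) i * (norm (?e i))\<^sup>2)"
    by (rule sum_mono) (rule step)
  then show ?thesis
    unfolding sum.distrib tele sum_distrib_left[symmetric] sum_norm_block[OF blocks]
    unfolding sum_subtractf \<xi>_def F_val_def by linarith
qed

section \<open>The energy bounded by two consecutive steps\<close>

lemma value_gap:
  assumes k: "1 \<le> k"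
  shows "F_val (x (Suc k)) - Fmin
    \<le> (real m * (M + B))\<^sup>2 / \<nu> * (norm (D k) + norm (D (k - 1)))\<^sup>2"
proof -
  let ?p = "x (Suc k)"
  obtain z where z: "F z = ereal Fmin" "ereal (\<nu> * (norm (?p - z))\<^sup>2) \<le> F ?p - ereal Fmin"
    using obtain_near_minimizer by blast
  have Fz: "Fmin = F_val z" using F_eq_val(1)[of z] z(1) by simp
  have grow: "\<nu> * (norm (?p - z))\<^sup>2 \<le> F_val ?p - Fmin"
    using z(2) F_eq_val(1)[OF F_finite[OF k]] by simp
  define E where "E = norm (D k) + norm (D (k - 1))"
  define s where "s = norm (?p - z)"
  \<comment> \<open>By convexity of \<open>f\<close> at \<open>?p\<close>, the value gap is at most
    the sum of these terms over the blocks.\<close>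
  have term_le: "G ?p \<bullet> block b i (?p - z) + (g_val i ?p - g_val i z) \<le> (M + B) * E * s"
    if i: "i \<in> {1..m}" for i
  proof -
    let ?v = "block b i (?p - z)" and ?n = "block b i (G (W k i))"
    have \<beta>: "0 \<le> \<beta> k i" "\<beta> k i \<le> 1" using \<beta>_range i by (auto intro: less_imp_le)
    have \<gamma>: "0 < \<gamma> k i" "1 / \<gamma> k i \<le> B" using \<gamma>_pos inverse_\<gamma>_le i by auto
    have eq: "block b i (z - ?p) = - ?v" by (simp add: block_diff)
    have inn: "(- block b i (D k) - \<gamma> k i *\<^sub>R ?n + \<beta> k i *\<^sub>R block b i (D (k - 1))) \<bullet> (- ?v) / \<gamma> k i
        = 1 / \<gamma> k i * ((block b i (D k) - \<beta> k i *\<^sub>R block b i (D (k - 1))) \<bullet> ?v) + ?n \<bullet> ?v"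
      using \<gamma>(1) by (simp add: inner_diff_left inner_add_left field_simps)
    \<comment> \<open>Testing the proximal step at the minimizer \<open>z\<close> produces the
      gradient at the sweep point \<open>W k i\<close> instead of \<open>?p\<close>; the two
      differences are estimated separately.\<close>
    have "g_val i ?p - g_val i z
        \<le> - (1 / \<gamma> k i * ((block b i (D k) - \<beta> k i *\<^sub>R block b i (D (k - 1))) \<bullet> ?v)) - ?n \<bullet> ?v"
      using prox_step_val[OF k i, of z] z(1) unfolding eq inn by simp
    moreover have "G ?p \<bullet> ?v - ?n \<bullet> ?v = (G ?p - G (W k i)) \<bullet> ?v"
      by (simp add: inner_diff_left inner_block_left block_id)
    \<comment> \<open>The sweep point already agrees with \<open>?p\<close> on the updated blocks,
      so their distance is at most \<open>norm (D k)\<close>.\<close>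
    moreover have "(G ?p - G (W k i)) \<bullet> ?v \<le> M * E * s"
    proof -
      have "(G ?p - G (W k i)) \<bullet> ?v \<le> norm (G ?p - G (W k i)) * norm ?v"
        by (rule norm_cauchy_schwarz)
      also have "\<dots> \<le> (M * E) * s"
      proof (rule mult_mono)
        have "norm (G ?p - G (W k i)) \<le> M * norm (?p - W k i)" by (rule gradient_lipschitz)
        also have "\<dots> \<le> M * norm (D k)"
          unfolding W_def D_def using M_pos
          by (intro mult_left_mono norm_minus_sweep_point_le) simp
        also have "\<dots> \<le> M * E" using M_pos by (intro mult_left_mono) (auto simp: E_def)
        finally show "norm (G ?p - G (W k i)) \<le> M * E" .
      qed (use M_pos in \<open>auto simp: s_def E_def norm_block_le\<close>)
      finally show ?thesis .
    qed
    \<comment> \<open>The remaining part, from the step itself and its inertia, costs the factor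
      \<open>B\<close> for \<open>1 / \<gamma> k i\<close>.\<close>
    moreover have "- (1 / \<gamma> k i * ((block b i (D k) - \<beta> k i *\<^sub>R block b i (D (k - 1))) \<bullet> ?v)) \<le> B * (E * s)"
    proof -
      have "norm (block b i (D k) - \<beta> k i *\<^sub>R block b i (D (k - 1)))
          \<le> norm (block b i (D k)) + norm (\<beta> k i *\<^sub>R block b i (D (k - 1)))"
        by (rule norm_triangle_ineq4)
      also have "norm (\<beta> k i *\<^sub>R block b i (D (k - 1))) \<le> 1 * norm (D (k - 1))"
        unfolding norm_scaleR using \<beta> by (intro mult_mono norm_block_le) auto
      finally have nE: "norm (block b i (D k) - \<beta> k i *\<^sub>R block b i (D (k - 1))) \<le> E"
        using norm_block_le[of b i "D k"] by (simp add: E_def)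
      have "- ((block b i (D k) - \<beta> k i *\<^sub>R block b i (D (k - 1))) \<bullet> ?v)
          \<le> norm (block b i (D k) - \<beta> k i *\<^sub>R block b i (D (k - 1))) * norm ?v"
        using Cauchy_Schwarz_ineq2[of "block b i (D k) - \<beta> k i *\<^sub>R block b i (D (k - 1))" ?v]
        by linarith
      also have "\<dots> \<le> E * s"
        using nE by (intro mult_mono) (auto simp: s_def E_def norm_block_le)
      finally have "1 / \<gamma> k i * - ((block b i (D k) - \<beta> k i *\<^sub>R block b i (D (k - 1))) \<bullet> ?v)
          \<le> 1 / \<gamma> k i * (E * s)"
        using \<gamma>(1) by (intro mult_left_mono) auto
      also have "\<dots> \<le> B * (E * s)"
        using \<gamma>(2) by (intro mult_right_mono) (auto simp: E_def s_def)
      finally show ?thesis by simp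
    qed
    ultimately show ?thesis by (simp add: algebra_simps)
  qed
  have inner_sum: "(\<Sum>i=1..m. G ?p \<bullet> block b i (?p - z)) = (?p - z) \<bullet> G ?p"
    using sum_inner_block[OF blocks, of "?p - z" "G ?p"] by (simp add: inner_commute)
  have "f ?p + G ?p \<bullet> (z - ?p) \<le> f z"
    using convex_on_above_gradient[OF f_convex gradient, of ?p "z - ?p"] by simp
  then have "F_val ?p - Fmin \<le> (?p - z) \<bullet> G ?p + ((\<Sum>i=1..m. g_val i ?p) - (\<Sum>i=1..m. g_val i z))"
    unfolding Fz F_val_def by (simp add: inner_diff_right inner_diff_left inner_commute)
  also have "\<dots> = (\<Sum>i=1..m. G ?p \<bullet> block b i (?p - z) + (g_val i ?p - g_val i z))"
    unfolding sum.distrib sum_subtractf inner_sum ..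
  also have "\<dots> \<le> (\<Sum>i=1..m. (M + B) * E * s)" by (rule sum_mono) (rule term_le)
  also have "\<dots> = real m * (M + B) * E * s" by simp
  finally show ?thesis
    using quadratic_growth_bound[OF \<nu>_pos grow] unfolding E_def s_def by simp
qed

lemma \<xi>_ge: "F_val (x (Suc k)) - Fmin \<le> \<xi> k"
proof -
  have "0 \<le> (\<Sum>i=1..m. \<delta> (Suc k) i * (norm (block b i (D k)))\<^sup>2)"
    by (intro sum_nonneg mult_nonneg_nonneg \<delta>_nonneg) auto
  then show ?thesis by (simp add: \<xi>_def)
qed

lemma \<xi>_le:
  assumes k: "1 \<le> k"
  shows "\<xi> k \<le> (2 * ((real m * (M + B))\<^sup>2 / \<nu>) + B) * ((norm (D k))\<^sup>2 + (norm (D (k - 1)))\<^sup>2)"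
proof -
  let ?K = "(real m * (M + B))\<^sup>2 / \<nu>" and ?S = "(norm (D k))\<^sup>2 + (norm (D (k - 1)))\<^sup>2"
  have distr: "(2 * K + B) * S = K * (2 * S) + B * S" for K S :: real
    by (simp add: algebra_simps)
  have "(\<Sum>i=1..m. \<delta> (Suc k) i * (norm (block b i (D k)))\<^sup>2)
      \<le> (\<Sum>i=1..m. B * (norm (block b i (D k)))\<^sup>2)"
    using \<delta>_le by (intro sum_mono mult_right_mono) auto
  also have "\<dots> = B * (norm (D k))\<^sup>2"
    unfolding sum_distrib_left[symmetric] sum_norm_block[OF blocks] ..
  also have "\<dots> \<le> B * ?S" using B_pos by simp
  finally have 1: "(\<Sum>i=1..m. \<delta> (Suc k) i * (norm (block b i (D k)))\<^sup>2) \<le> B * ?S" .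
  have "(norm (D k) + norm (D (k - 1)))\<^sup>2 \<le> 2 * ?S"
    using zero_le_power2[of "norm (D k) - norm (D (k - 1))"]
    by (simp add: power2_eq_square algebra_simps)
  then have "?K * (norm (D k) + norm (D (k - 1)))\<^sup>2 \<le> ?K * (2 * ?S)"
    using \<nu>_pos by (intro mult_left_mono) auto
  then have "F_val (x (Suc k)) - Fmin \<le> ?K * (2 * ?S)"
    using value_gap[OF k] by linarith
  moreover have "(2 * ?K + B) * ?S = ?K * (2 * ?S) + B * ?S" by (rule distr)
  ultimately show ?thesis using 1 unfolding \<xi>_def by linarith
qed

section \<open>The linear rate\<close>

lemma linear_convergence:
  "\<exists>\<omega>. 0 < \<omega> \<and> \<omega> < 1 \<and> (\<forall>\<^sub>F k in sequentially. F (x k) \<noteq> \<infinity>) \<and>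
     (\<lambda>k. real_of_ereal (F (x k) - min_val F)) \<in> O(\<lambda>k. \<omega> ^ k)"
proof -
  \<comment> \<open>The smallest block margin in the energy decrease.\<close>
  define a where "a = Min (L ` {1..m}) * (1 - c) / (2 * c)"
  have "L ` {1..m} \<noteq> {}" using m_pos by auto
  then have "0 < Min (L ` {1..m})" using L_pos by (subst Min_gr_iff) auto
  then have a_pos: "0 < a" using c_range by (simp add: a_def)
  have a_le: "a \<le> L i * (1 - c) / (2 * c)" if "i \<in> {1..m}" for i
    using that c_range unfolding a_def by (intro divide_right_mono mult_right_mono Min_le) auto
  define C where "C = 2 * ((real m * (M + B))\<^sup>2 / \<nu>) + B"
  have C_pos: "0 < C" using \<nu>_pos B_pos by (auto simp: C_def intro!: add_nonneg_pos)
  \<comment> \<open>Obtained by solving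
    \<open>a * \<xi> (k + 2) \<le> C * (\<xi> k - \<xi> (k + 2))\<close> for
    \<open>\<xi> (k + 2)\<close>.\<close>
  define q where "q = C / (C + a)"
  have q: "0 < q" "q < 1" using C_pos a_pos by (auto simp: q_def)
  have "\<xi> (k + 2) \<le> q * \<xi> k" if k: "1 \<le> k" for k
  proof -
    have "\<xi> (k + 2) \<le> C * ((norm (D (k + 2)))\<^sup>2 + (norm (D (Suc k)))\<^sup>2)"
      using \<xi>_le[of "k + 2"] by (simp add: C_def)
    then have "a * \<xi> (k + 2) \<le> a * (C * ((norm (D (k + 2)))\<^sup>2 + (norm (D (Suc k)))\<^sup>2))"
      using a_pos by (intro mult_left_mono) auto
    also have "\<dots> = C * (a * (norm (D (k + 2)))\<^sup>2 + a * (norm (D (Suc k)))\<^sup>2)"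
      by (simp add: algebra_simps)
    \<comment> \<open>The sum of the energy decreases at \<open>k\<close> and \<open>Suc k\<close>,
      which cover exactly the two steps in the bound.\<close>
    also have "\<dots> \<le> C * (\<xi> k - \<xi> (k + 2))"
      using \<xi>_decrease[OF k a_le] \<xi>_decrease[of "Suc k", OF _ a_le] C_pos
      by (intro mult_left_mono) (auto simp: numeral_2_eq_2)
    finally show ?thesis using a_pos C_pos by (simp add: q_def field_simps)
  qed
  note step = this
  \<comment> \<open>\<open>\<xi> (k - 1)\<close> is the energy that contains the value at
    \<open>x k\<close>.\<close>
  have big: "(\<lambda>k. \<xi> (k - 1)) \<in> O(\<lambda>k. sqrt q ^ k)"
  proof (rule two_step_contraction_bigo[of 2])
    fix k :: nat assume k: "2 \<le> k"
    have "1 \<le> k - 1" using k by simp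
    from F_val_ge[OF this] \<xi>_ge[of "k - 1"] show "0 \<le> \<xi> (k - 1)" by linarith
    show "\<xi> (k + 2 - 1) \<le> q * \<xi> (k - 1)"
      using step[of "k - 1"] k by simp
  qed (rule q)
  have "(\<lambda>k. real_of_ereal (F (x k) - min_val F)) \<in> O(\<lambda>k. \<xi> (k - 1))"
  proof (rule bigoI)
    have "norm (real_of_ereal (F (x k) - min_val F)) \<le> 1 * norm (\<xi> (k - 1))" if k: "2 \<le> k" for k
    proof -
      obtain l where l: "k = Suc l" "1 \<le> l" using k by (cases k) auto
      show ?thesis
        using \<xi>_ge[of l] F_val_ge[OF l(2)] F_eq_val(1)[OF F_finite[OF l(2)]]
        by (simp add: min_val_eq l(1))
    qed
    then show "\<forall>\<^sub>F k in sequentially.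
        norm (real_of_ereal (F (x k) - min_val F)) \<le> 1 * norm (\<xi> (k - 1))"
      unfolding eventually_sequentially by blast
  qed
  from landau_o.big_trans[OF this big]
  have "(\<lambda>k. real_of_ereal (F (x k) - min_val F)) \<in> O(\<lambda>k. sqrt q ^ k)" .
  \<comment> \<open>Without this, the bound could hold merely because \<open>real_of_ereal\<close>
    sends an infinite gap to \<open>0\<close>.\<close>
  moreover have "\<forall>\<^sub>F k in sequentially. F (x k) \<noteq> \<infinity>"
    unfolding eventually_sequentially
  proof (intro exI[of _ 2] allI impI)
    fix k :: nat assume "2 \<le> k"
    then show "F (x k) \<noteq> \<infinity>" using F_finite[of "k - 1"] by simp
  qed
  \<comment> \<open>The factor \<open>q\<close> is gained over two iterations, hence the square root
    per iteration.\<close>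
  ultimately show ?thesis using q by (intro exI[of _ "sqrt q"]) auto
qed

end

theorem theorem5:
  fixes m :: nat
    and b :: "'n::finite \<Rightarrow> nat"
    and f :: "real ^ 'n \<Rightarrow> real"
    and g :: "nat \<Rightarrow> real ^ 'n \<Rightarrow> ereal"
    and L :: "nat \<Rightarrow> real"
    and F :: "real ^ 'n \<Rightarrow> ereal"
    and \<nu> c \<beta>lo \<beta>hi :: real
    and \<beta> \<gamma> :: "nat \<Rightarrow> nat \<Rightarrow> real"
    and x :: "nat \<Rightarrow> real ^ 'n"
  assumes blocks: "\<forall>j. b j \<in> {1..m}"
    and f_convex: "convex_on UNIV f"
    and f_diff: "f differentiable_on UNIV"
    and L_pos: "\<forall>i\<in>{1..m}. 0 < L i"
    and L_lipschitz: "\<forall>i\<in>{1..m}. \<forall>y. \<forall>u\<in>block_space b i. \<forall>v\<in>block_space b i.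
          norm (partial_grad b i f (subst_block b i y u) - partial_grad b i f (subst_block b i y v))
            \<le> L i * norm (u - v)"
    and g_proper: "\<forall>i\<in>{1..m}. proper_on (block_space b i) (g i)"
    and g_lsc: "\<forall>i\<in>{1..m}. lsc_on (block_space b i) (g i)"
    and g_convex: "\<forall>i\<in>{1..m}. econvex_on (block_space b i) (g i)"
    and F_eq: "F = composite b m f g"
    and min_attained: "argmin_set F \<noteq> {}"
    and min_finite: "\<bar>min_val F\<bar> \<noteq> \<infinity>"
    and \<nu>_pos: "0 < \<nu>"
    and growth: "\<forall>y. F y - min_val F \<ge> ereal (\<nu> * (norm (y - closest_point (argmin_set F) y))\<^sup>2)"
    and \<beta>_range: "\<forall>k. \<forall>i\<in>{1..m}. \<beta> k i \<in> {0..<1}"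
    and \<beta>_decreasing: "\<forall>i\<in>{1..m}. decseq (\<lambda>k. \<beta> k i)"
    and \<beta>lo_pos: "0 < \<beta>lo"
    and \<beta>_bounds: "\<forall>k. \<forall>i\<in>{1..m}. \<beta>lo \<le> \<beta> k i \<and> \<beta> k i \<le> \<beta>hi"
    and \<beta>hi_less: "\<beta>hi < 1"
    and c_range: "0 < c" "c < 1"
    and \<gamma>_eq: "\<forall>k. \<forall>i\<in>{1..m}. \<gamma> k i = 2 * (1 - \<beta> k i) * c / L i"
    and scheme: "\<forall>k\<ge>1. \<forall>i\<in>{1..m}.
          block b i (x (k + 1)) =
            prox (block_space b i) (\<gamma> k i) (g i)
              (block b i (x k)
                - \<gamma> k i *\<^sub>R partial_grad b i f (sweep_point b i (x (k + 1)) (x k))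
                + \<beta> k i *\<^sub>R (block b i (x k) - block b i (x (k - 1))))"
  shows "\<exists>\<omega>. 0 < \<omega> \<and> \<omega> < 1 \<and>
           (\<forall>\<^sub>F k in sequentially. F (x k) \<noteq> \<infinity>) \<and>
           (\<lambda>k. real_of_ereal (F (x k) - min_val F)) \<in> O(\<lambda>k. \<omega> ^ k)"
proof -
  obtain G where G: "\<And>z. GDERIV f z :> G z"
    using obtain_gradient[OF f_diff] by blast
  have \<beta>_le: "\<forall>k. \<forall>i\<in>{1..m}. \<beta> k i \<le> \<beta>hi" using \<beta>_bounds by blast
  interpret inertial_block_prox m b f G g L F \<nu> c \<beta>hi \<beta> \<gamma> x
    by (rule inertial_block_prox.intro[OF blocks f_convex G L_pos L_lipschitz g_proper g_lsc g_convex
      F_eq min_attained min_finite \<nu>_pos growth \<beta>_range \<beta>_decreasing \<beta>_le \<beta>hi_less c_range \<gamma>_eq scheme])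
  show ?thesis by (rule linear_convergence)
qed

end
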